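(* Let $\lambda$ be a partition of $n$ and $0\le k\le n/2$. Then $a_{nk}(\lambda)=q^{nk-k^2-\mathsf{n}(\lambda')}\,\bar a_{nk}(\lambda)$, where \[ \bar a_{nk}(\lambda)=\sum_{j=0}^k(-1)^jq^{-\binom{j+1}{2}-(n-2k)j}{n-2k+j\brack j}_q\frac{q^{n-2k+2j}-1}{q^{n-2k+j}-1}\sum_{\nu\vdash n-k+j,\ \rho\vdash k-j}\frac{q^{\mathsf{n}(\nu')+\mathsf{n}(\rho')}f^\lambda_{\nu\rho}(1)}{[\nu]_q!\,[\rho]_q!}, \] with the convention $(q^0-1)/(q^0-1)=1$.
   Context: For a prime power $q$ and a partition $\lambda=(\lambda_1,\dots,\lambda_s)$ of $n$, $\mathfrak{u}_\lambda(\mathbb{F}_q)$ is the nilradical of the standard parabolic subalgebra of $\mathfrak{gl}_n(\mathbb{F}_q)$ with diagonal blocks of sizes $\lambda_1,\dots,\lambda_s$, and $a_{nk}(\lambda)=\#\{X\in\mathfrak{u}_\lambda(\mathbb{F}_q):X^2=0,\ \mathrm{rank}(X)=k\}$. $\lambda'$ is the conjugate partition, $\mathsf{n}(\lambda)=\sum_i(i-1)\lambda_i$. $[m]_q=(q^m-1)/(q-1)$, $[m]_q!=[1]_q\cdots[m]_q$, $[\nu]_q!=\prod_i[\nu_i]_q!$, ${m\brack j}_q=[m]_q!/([j]_q![m-j]_q!)$. The $f^\lambda_{\nu\rho}(t)$ are the Hall–Littlewood structure constants: $P_\nu(\mathbf{x};t)P_\rho(\mathbf{x};t)=\sum_\lambda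 f^\lambda_{\nu\rho}(t)P_\lambda(\mathbf{x};t)$ where $P_\lambda(\mathbf{x};t)$ are the Hall–Littlewood symmetric functions (at $t=1$ these are the monomial symmetric functions, so $f^\lambda_{\nu\rho}(1)$ is the coefficient of $m_\lambda$ in $m_\nu m_\rho$).
   Formalization: The formal identity has an extra factor $[\lambda]_q!$ on the right: $a_{nk}(\lambda)=q^{nk-k^2-\mathsf{n}(\lambda')}[\lambda]_q!\,\bar a_{nk}(\lambda)$; without it the formula fails, e.g. for $n=2$, $k=0$, $\lambda=(2)$ it gives $1/(q+1)$ instead of $1$. *)

theory Defs
  imports
    Complex_Main
    "HOL-Library.Cardinality"
    "HOL-Library.Multiset"
    "Jordan_Normal_Form.DL_Rank"
begin

section \<open>Partitions\<close>

definition partitions :: "nat \<Rightarrow> nat list set" where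
  "partitions n = {lam. sorted_wrt (\<ge>) lam \<and> 0 \<notin> set lam \<and> sum_list lam = n}"

(* The j-th entry counts the parts that are at least j, for 1 \<le> j \<le> largest part. *)
definition conj_partition :: "nat list \<Rightarrow> nat list" where
  "conj_partition lam = map (\<lambda>j. length (filter (\<lambda>p. j \<le> p) lam)) [1..<Suc (foldr max lam 0)]"

(* With 0-based list indices the weight i - 1 of the i-th part becomes the index itself. *)
definition n_stat :: "nat list \<Rightarrow> nat" where
  "n_stat lam = (\<Sum>i<length lam. i * lam ! i)"

section \<open>q-analogues\<close>

definition q_int :: "real \<Rightarrow> nat \<Rightarrow> real" where
  "q_int q m = (q ^ m - 1) / (q - 1)"

definition q_fact :: "real \<Rightarrow> nat \<Rightarrow> real" where
  "q_fact q m = (\<Prod>i=1..m. q_int q i)"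

definition q_fact_list :: "real \<Rightarrow> nat list \<Rightarrow> real" where
  "q_fact_list q nu = prod_list (map (q_fact q) nu)"

definition q_binom :: "real \<Rightarrow> nat \<Rightarrow> nat \<Rightarrow> real" where
  "q_binom q m j = q_fact q m / (q_fact q j * q_fact q (m - j))"

section \<open>Hall-Littlewood symmetric functions and their structure constants\<close>

(* The distinct rearrangements of (lam_1, ..., lam_s, 0, ..., 0) in N^m;
   there are none if lam has more than m parts. *)
definition rearrangements :: "nat \<Rightarrow> nat list \<Rightarrow> nat list set" where
  "rearrangements m lam =
     {al. length al = m \<and> filter_mset (\<lambda>p. p \<noteq> 0) (mset al) = mset lam}"

(* P_lam(x_0, ..., x_{m-1}; t), evaluated at a point with pairwise distinct coordinates, as
   the sum over w in S_m / Stab(lam) of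
     w (x^lam * prod_{lam_i > lam_j} (x_i - t x_j) / (x_i - x_j)).
   The cosets of the stabilizer correspond to the distinct rearrangements of lam.
   Unlike the form 1 / v_lam(t) times a sum over all of S_m, this one has no denominator
   depending on t, so it is meaningful at every t. *)
definition hall_littlewood_P :: "nat \<Rightarrow> (nat \<Rightarrow> real) \<Rightarrow> real \<Rightarrow> nat list \<Rightarrow> real" where
  "hall_littlewood_P m x t lam =
     (\<Sum>al\<in>rearrangements m lam.
        (\<Prod>i<m. x i ^ (al ! i)) *
        (\<Prod>(i, j)\<in>{(i, j). i < m \<and> j < m \<and> al ! j < al ! i}.
           (x i - t * x j) / (x i - x j)))"

(* c lam = f^lam_{nu rho}(t). An identity of symmetric functions is an identity of polynomials
   in m variables for every m, which over an infinite field can be tested on the points with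
   pairwise distinct coordinates. For each fixed t the P_lam(x; t) form a basis of the ring of
   symmetric functions, so that the finitely supported family c exists and is unique. *)
definition is_hl_expansion :: "nat list \<Rightarrow> nat list \<Rightarrow> real \<Rightarrow> (nat list \<Rightarrow> real) \<Rightarrow> bool" where
  "is_hl_expansion nu rho t c \<longleftrightarrow>
     finite {lam. c lam \<noteq> 0} \<and>
     (\<forall>lam. c lam \<noteq> 0 \<longrightarrow> lam \<in> (\<Union>n. partitions n)) \<and>
     (\<forall>m x. inj_on x {..<m} \<longrightarrow>
        hall_littlewood_P m x t nu * hall_littlewood_P m x t rho =
        (\<Sum>lam | c lam \<noteq> 0. c lam * hall_littlewood_P m x t lam))"

definition hl_coeff :: "nat list \<Rightarrow> nat list \<Rightarrow> nat list \<Rightarrow> real \<Rightarrow> real" where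
  "hl_coeff lam nu rho t = (THE c. is_hl_expansion nu rho t c) lam"

section \<open>Nilradical and the counting function\<close>

(* The (0-based) index of the diagonal block containing row/column i < sum_list lam. *)
definition block_index :: "nat list \<Rightarrow> nat \<Rightarrow> nat" where
  "block_index lam i = (LEAST r. i < sum_list (take (Suc r) lam))"

(* The standard parabolic consists of the block upper triangular matrices; its nilradical,
   in the usual sense of the Lie algebra of the unipotent radical, of the strictly block upper
   triangular ones. *)
definition nilradical :: "nat list \<Rightarrow> 'a::field mat set" where
  "nilradical lam =
     {X \<in> carrier_mat (sum_list lam) (sum_list lam).
        \<forall>i<sum_list lam. \<forall>j<sum_list lam.
          \<not> block_index lam i < block_index lam j \<longrightarrow> X $$ (i, j) = 0}"

definition a_count :: "'a::{field, finite} itself \<Rightarrow> nat \<Rightarrow> nat \<Rightarrow> nat list \<Rightarrow> nat" where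
  "a_count (_ :: 'a itself) n k lam =
     card {X \<in> nilradical lam :: 'a mat set.
             X * X = 0\<^sub>m n n \<and> vec_space.rank n X = k}"

(* This sum is the count a_nk(lam) divided by q^(nk - k^2 - n(lam')) and by [lam]_q!. For k = 0
   and q > 1 it is q^n(lam') / [lam]_q!, while the count is 1, so the factor [lam]_q! is needed.
   Natural subtraction is not truncated as long as 2 * k \<le> n, and n - 2 * k + j = 0 only
   if n = 2 * k and j = 0, where the quotient is (q^0 - 1) / (q^0 - 1), read as 1. *)
definition a_bar :: "real \<Rightarrow> nat \<Rightarrow> nat \<Rightarrow> nat list \<Rightarrow> real" where
  "a_bar q n k lam =
     (\<Sum>j\<le>k.
        (-1) ^ j
        * q powi (- int ((j + 1) choose 2) - int ((n - 2 * k) * j))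
        * q_binom q (n - 2 * k + j) j
        * (if n - 2 * k + j = 0 then 1
           else (q ^ (n - 2 * k + 2 * j) - 1) / (q ^ (n - 2 * k + j) - 1))
        * (\<Sum>nu\<in>partitions (n - k + j). \<Sum>rho\<in>partitions (k - j).
             q ^ (n_stat (conj_partition nu) + n_stat (conj_partition rho)) * hl_coeff lam nu rho 1
             / (q_fact_list q nu * q_fact_list q rho)))"

end

theory Submission
  imports Defs "HOL-Combinatorics.Permutations"
begin

text \<open>With \<open>p = 1 / q\<close> let \<open>H\<^sub>m(t)\<close> be the Rogers-Szego polynomial, whose coefficients are the Gaussian
  binomials in base \<open>p\<close>. The columns in the last diagonal block of a square-zero matrix \<open>X\<close> in the
  nilradical are arbitrary vectors in the kernel of the remaining part of \<open>X\<close>, and counting them by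
  the resulting rank yields exactly the coefficients of the linearization formula for
  \<open>H\<^sub>M(t) H\<^sub>m(t)\<close>. Induction on the number of blocks therefore shows that the sum of
  \<open>p^(r (n - r)) t^r H\<^bsub>n - 2 r\<^esub>(t)\<close> over all such \<open>X\<close>, where \<open>r\<close> is the rank of \<open>X\<close>, equals the product of
  the \<open>H\<^bsub>\<lambda>\<^sub>i\<^esub>(t)\<close>. The number of \<open>X\<close> of rank \<open>k\<close> is then extracted by an orthogonality
  relation, and expanding the product of the \<open>H\<^bsub>\<lambda>\<^sub>i\<^esub>(t)\<close> produces the structure constants at \<open>t = 1\<close>,
  which count the ways to write \<open>\<lambda>\<close> as a sum of rearrangements of \<open>\<nu>\<close> and \<open>\<rho>\<close>.\<close>

section \<open>Rogers-Szego polynomials\<close>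

text \<open>Let a matrix of size n have rank l, and put M = n - 2 l. The number of ways to append a
  block of m columns that raises the rank by i is q^(l m) times the number of M x m matrices of rank
  i. The latter is q^(i (M + m - i)) times a polynomial in 1/q, which explains the base p = 1/q; the
  weight p^(r (n - r)) is chosen to absorb all these powers of q. As t^r H_(n-2r)(t) has lowest term
  t^r, the coefficients of t^0, ..., t^k in the product of the H's determine the weighted counts for
  the ranks up to k through a unitriangular system. The inverse of this system has a closed form,
  and its last row is the alternating sum over j in \<open>a_bar\<close>. The structure constants
  are given by a definite description over an identity at points with distinct coordinates, so
  evaluating them takes both the existence and the uniqueness of the expansion.\<close>

lemma smult_sum_right: "Polynomial.smult c (sum f A) = (\<Sum>x\<in>A. Polynomial.smult c (f x))"
  by (induction A rule: infinite_finite_induct) (simp_all add: smult_add_right)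

section \<open>Gaussian binomials and their recurrences\<close>

definition qpoch :: "real \<Rightarrow> nat \<Rightarrow> real" where
  "qpoch p n = (\<Prod>i<n. 1 - p ^ Suc i)"

definition gauss_binom :: "real \<Rightarrow> nat \<Rightarrow> nat \<Rightarrow> real" where
  "gauss_binom p n k = (if k \<le> n then qpoch p n / (qpoch p k * qpoch p (n - k)) else 0)"

definition rogers_szego :: "real \<Rightarrow> nat \<Rightarrow> real poly" where
  "rogers_szego p n = (\<Sum>b\<le>n. monom (gauss_binom p n b) b)"

lemma qpoch_0 [simp]: "qpoch p 0 = 1"
  by (simp add: qpoch_def)

lemma qpoch_Suc: "qpoch p (Suc n) = qpoch p n * (1 - p ^ Suc n)"
  by (simp add: qpoch_def)

lemma gauss_binom_0 [simp]:
  assumes "0 < p" "p < 1"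
  shows "gauss_binom p n 0 = 1"
proof -
  have "qpoch p n > 0"
    unfolding qpoch_def using assms power_Suc_less_one[of p] by (intro prod_pos) (auto simp del: power_Suc)
  thus ?thesis by (simp add: gauss_binom_def)
qed

lemma gauss_binom_eq_0: "n < k \<Longrightarrow> gauss_binom p n k = 0"
  by (simp add: gauss_binom_def)

lemma coeff_rogers_szego [simp]: "coeff (rogers_szego p n) b = gauss_binom p n b"
  by (auto simp: rogers_szego_def coeff_sum gauss_binom_eq_0)

context
  fixes p :: real
  assumes p01: "0 < p" "p < 1"
begin

lemma one_minus_power_pos: "0 < n \<Longrightarrow> 0 < 1 - p ^ n"
  using p01 by (simp add: power_less_one_iff)

lemma one_minus_power_Suc_neq: "1 - p ^ Suc n \<noteq> 0"
  using one_minus_power_pos[of "Suc n"] by simp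

lemma qpoch_neq_0: "qpoch p n \<noteq> 0"
  unfolding qpoch_def using one_minus_power_Suc_neq by (simp add: prod_zero_iff)

lemma gauss_binom_absorb:
  "(1 - p ^ Suc b) * gauss_binom p (Suc n) (Suc b) = (1 - p ^ Suc n) * gauss_binom p n b"
  using qpoch_neq_0 one_minus_power_Suc_neq[of b]
  by (simp add: gauss_binom_def qpoch_Suc divide_simps del: power_Suc)

lemma gauss_binom_absorb_comp:
  "(1 - p ^ (Suc n - b)) * gauss_binom p (Suc n) b = (1 - p ^ Suc n) * gauss_binom p n b"
proof -
  consider "b \<le> n" | "b = Suc n" | "b > Suc n" by linarith
  thus ?thesis
  proof cases
    case 1
    hence "Suc n - b = Suc (n - b)" by simp
    with 1 show ?thesis using qpoch_neq_0 one_minus_power_Suc_neq[of "n - b"]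
      by (simp add: gauss_binom_def qpoch_Suc divide_simps del: power_Suc)
  qed (simp_all add: gauss_binom_def)
qed

text \<open>After multiplication by 1 - p^(n+1) the two absorption rules turn every term into a
  multiple of the same binomial, and what remains is (1 - p^(b+1)) + p^(b+1) (1 - p^(n-b)) = 1 -
  p^(n+1). The primed variant splits 1 - p^(n+1) the other way.\<close>

lemma gauss_binom_pascal:
  "gauss_binom p (Suc n) (Suc b) = p ^ Suc b * gauss_binom p n (Suc b) + gauss_binom p n b"
proof -
  have b: "(1 - p ^ (n - b)) * gauss_binom p (Suc n) (Suc b) = (1 - p ^ Suc n) * gauss_binom p n (Suc b)"
    using gauss_binom_absorb_comp[of n "Suc b"] by simp
  consider "b \<le> n" | "b > n" by linarith
  thus ?thesis
  proof cases
    case 1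
    hence e: "p ^ Suc n = p ^ Suc b * p ^ (n - b)" by (simp flip: power_add)
    have "(1 - p ^ Suc n) * (p ^ Suc b * gauss_binom p n (Suc b) + gauss_binom p n b)
       = p ^ Suc b * ((1 - p ^ (n - b)) * gauss_binom p (Suc n) (Suc b))
          + (1 - p ^ Suc b) * gauss_binom p (Suc n) (Suc b)"
      unfolding b gauss_binom_absorb by (simp only: algebra_simps)
    also have "\<dots> = (1 - p ^ Suc n) * gauss_binom p (Suc n) (Suc b)"
      unfolding e by (simp only: algebra_simps)
    finally show ?thesis using one_minus_power_Suc_neq[of n] by simp
  qed (simp_all add: gauss_binom_def)
qed

lemma gauss_binom_pascal':
  "gauss_binom p (Suc n) (Suc b) = gauss_binom p n (Suc b) + p ^ (n - b) * gauss_binom p n b"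
proof -
  have b: "(1 - p ^ (n - b)) * gauss_binom p (Suc n) (Suc b) = (1 - p ^ Suc n) * gauss_binom p n (Suc b)"
    using gauss_binom_absorb_comp[of n "Suc b"] by simp
  consider "b \<le> n" | "b > n" by linarith
  thus ?thesis
  proof cases
    case 1
    hence e: "p ^ Suc n = p ^ Suc b * p ^ (n - b)" by (simp flip: power_add)
    have "(1 - p ^ Suc n) * (gauss_binom p n (Suc b) + p ^ (n - b) * gauss_binom p n b)
       = (1 - p ^ (n - b)) * gauss_binom p (Suc n) (Suc b)
          + p ^ (n - b) * ((1 - p ^ Suc b) * gauss_binom p (Suc n) (Suc b))"
      unfolding b gauss_binom_absorb by (simp only: algebra_simps)
    also have "\<dots> = (1 - p ^ Suc n) * gauss_binom p (Suc n) (Suc b)"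
      unfolding e by (simp only: algebra_simps)
    finally show ?thesis using one_minus_power_Suc_neq[of n] by simp
  qed (simp_all add: gauss_binom_def)
qed

section \<open>Three-term recurrence of the Rogers-Szego polynomials\<close>

lemma rogers_szego_0: "rogers_szego p 0 = 1"
  by (rule poly_eqI) (auto simp: gauss_binom_def)

lemma rogers_szego_1: "rogers_szego p (Suc 0) = [:1, 1:]"
proof (rule poly_eqI)
  fix b
  show "coeff (rogers_szego p (Suc 0)) b = coeff [:1, 1:] b"
  proof (cases b)
    case (Suc c)
    thus ?thesis using p01 by (cases c) (auto simp: gauss_binom_def qpoch_def)
  qed (use p01 in auto)
qed

text \<open>Multiplying by 1 + t adds neighbouring binomials without the factor p^(c+1) of the
  Pascal rule. The resulting defect (1 - p^(c+1)) [n+1, c+1] is absorbed into (1 - p^(n+1))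
  [n, c].\<close>

lemma rogers_szego_rec:
  "[:1, 1:] * rogers_szego p (Suc n) =
     rogers_szego p (Suc (Suc n)) + Polynomial.smult (1 - p ^ Suc n) (monom 1 1 * rogers_szego p n)"
proof (rule poly_eqI)
  fix b
  show "coeff ([:1, 1:] * rogers_szego p (Suc n)) b = coeff (rogers_szego p (Suc (Suc n))
     + Polynomial.smult (1 - p ^ Suc n) (monom 1 1 * rogers_szego p n)) b"
  proof (cases b)
    case 0
    thus ?thesis using p01 by (simp add: coeff_monom_mult)
  next
    case (Suc c)
    have "coeff ([:1, 1:] * rogers_szego p (Suc n)) b
        = gauss_binom p (Suc n) (Suc c) + gauss_binom p (Suc n) c"
      by (simp add: Suc)
    also have "\<dots> = gauss_binom p (Suc (Suc n)) (Suc c) + (1 - p ^ Suc n) * gauss_binom p n c"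
      unfolding gauss_binom_pascal[of "Suc n"] gauss_binom_absorb[symmetric] by (simp add: algebra_simps)
    finally show ?thesis by (simp add: Suc coeff_monom_mult)
  qed
qed

section \<open>Linearization of products of Rogers-Szego polynomials\<close>

definition lin_coeff :: "nat \<Rightarrow> nat \<Rightarrow> nat \<Rightarrow> real" where
  "lin_coeff M m i = gauss_binom p m i * (\<Prod>j<i. 1 - p ^ (M - j))"

lemma lin_coeff_0 [simp]: "lin_coeff M m 0 = 1"
  using p01 by (simp add: lin_coeff_def)

text \<open>For i <= M the coefficient is [M, i] [m, i] (p; p)_i, symmetric in M and m. For i > M
  the factor with j = M is 1 - p^0 = 0, so truncated subtraction in the exponents does no
  harm.\<close>

lemma lin_coeff_eq_0: "m < i \<or> M < i \<Longrightarrow> lin_coeff M m i = 0"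
  by (auto simp: lin_coeff_def gauss_binom_eq_0 intro!: bexI[of _ M])

lemma lin_coeff_rec:
  "lin_coeff M (Suc m) (Suc i) = lin_coeff M m (Suc i) + p ^ (m - i) * (1 - p ^ (M - i)) * lin_coeff M m i"
  by (simp add: lin_coeff_def gauss_binom_pascal' algebra_simps)

lemma lin_coeff_absorb:
  "(1 - p ^ Suc m) * lin_coeff M m i = (1 - p ^ (Suc m - i)) * lin_coeff M (Suc m) i"
  using gauss_binom_absorb_comp[of m i] by (simp add: lin_coeff_def)

text \<open>This is the comparison of coefficients in the step of \<open>rogers_szego_mult\<close>.
  Absorption rewrites the last term as a multiple of \<open>lin_coeff M (Suc m) i\<close>, and (1 -
  p^(M+m+1-2i)) - (1 - p^(m+1-i)) = p^(m+1-i) (1 - p^(M-i)) is the factor in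
  \<open>lin_coeff_rec\<close>.\<close>

lemma lin_coeff_rec2:
  assumes "i \<le> Suc m" "i \<le> M"
  shows "lin_coeff M (Suc (Suc m)) (Suc i) = lin_coeff M (Suc m) (Suc i)
    + (1 - p ^ (M + Suc m - 2 * i)) * lin_coeff M (Suc m) i - (1 - p ^ Suc m) * lin_coeff M m i"
proof -
  have "M + Suc m - 2 * i = (Suc m - i) + (M - i)" using assms by linarith
  hence "p ^ (M + Suc m - 2 * i) = p ^ (Suc m - i) * p ^ (M - i)" by (simp only: power_add)
  thus ?thesis unfolding lin_coeff_rec[of M "Suc m"] lin_coeff_absorb by (simp only: algebra_simps)
qed

text \<open>The three-term recurrence enters twice: it expresses H_(m+2) through (1 + t) H_(m+1) and
  t H_m, and it expands the products (1 + t) H_(M+m+1-2i) that arise from the induction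
  hypothesis.\<close>

lemma rogers_szego_mult:
  "rogers_szego p M * rogers_szego p m =
     (\<Sum>i\<le>m. Polynomial.smult (lin_coeff M m i) (monom 1 i * rogers_szego p (M + m - 2 * i)))"
proof (induction m rule: induct_nat_012)
  case 0
  show ?case by (simp add: rogers_szego_0 flip: one_pCons)
next
  case 1
  show ?case
  proof (cases M)
    case 0
    thus ?thesis by (simp add: rogers_szego_0 rogers_szego_1 lin_coeff_eq_0 flip: one_pCons)
  next
    case (Suc M')
    have "lin_coeff M (Suc 0) (Suc 0) = 1 - p ^ M"
      using p01 by (simp add: lin_coeff_rec lin_coeff_eq_0)
    thus ?thesis using rogers_szego_rec[of M'] Suc
      by (simp add: rogers_szego_1 mult.commute flip: one_pCons)
  qed
next
  case (ge2 m)
  define Q where "Q i = monom 1 i * rogers_szego p (M + Suc (Suc m) - 2 * i)" for i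
  define r where "r = lin_coeff M"
  have a: "[:1, 1:] * Polynomial.smult (r (Suc m) i) (monom 1 i * rogers_szego p (M + Suc m - 2 * i)) =
      Polynomial.smult (r (Suc m) i) (Q i) + Polynomial.smult ((1 - p ^ (M + Suc m - 2 * i)) * r (Suc m) i) (Q (Suc i))"
    if "i \<le> Suc m" for i
  proof (cases "i \<le> M")
    case True
    show ?thesis
    proof (cases "M + Suc m - 2 * i")
      \<comment> \<open>The recurrence starts at index 1, but its correction term would carry the
        coefficient 1 - p^0 = 0 here, so (1 + t) H_0 = H_1 fits the same formula.\<close>
      case 0
      hence "M + Suc (Suc m) - 2 * i = Suc 0" using True that by linarith
      with 0 show ?thesis by (simp add: Q_def rogers_szego_0 rogers_szego_1 mult.commute)
    next
      case (Suc k)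
      hence e: "M + Suc (Suc m) - 2 * i = Suc (Suc k)" "M + Suc (Suc m) - 2 * Suc i = k" using Suc by arith+
      have m: "monom 1 i * (monom 1 1 * R) = monom 1 (Suc i) * R" for R :: "real poly"
        by (simp add: mult_monom flip: mult.assoc)
      have "[:1, 1:] * Polynomial.smult (r (Suc m) i) (monom 1 i * rogers_szego p (Suc k))
        = Polynomial.smult (r (Suc m) i) (monom 1 i * ([:1, 1:] * rogers_szego p (Suc k)))"
        by (simp only: mult_smult_right mult.left_commute)
      also have "\<dots> = Polynomial.smult (r (Suc m) i) (monom 1 i * rogers_szego p (Suc (Suc k)))
        + Polynomial.smult ((1 - p ^ Suc k) * r (Suc m) i) (monom 1 (Suc i) * rogers_szego p k)"
        by (simp only: rogers_szego_rec distrib_left smult_add_right mult_smult_right m smult_smult mult.commute[of "r (Suc m) i"])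
      finally show ?thesis unfolding Q_def e Suc .
    qed
  qed (simp add: r_def lin_coeff_eq_0)
  have b: "monom 1 1 * Polynomial.smult (r m i) (monom 1 i * rogers_szego p (M + m - 2 * i)) = Polynomial.smult (r m i) (Q (Suc i))" for i
    by (simp add: Q_def mult_monom flip: mult.assoc)
  have "rogers_szego p M * rogers_szego p (Suc (Suc m)) =
      [:1, 1:] * (rogers_szego p M * rogers_szego p (Suc m))
        - Polynomial.smult (1 - p ^ Suc m) (monom 1 1 * (rogers_szego p M * rogers_szego p m))"
  proof -
    have "rogers_szego p M * ([:1, 1:] * rogers_szego p (Suc m)) = rogers_szego p M * rogers_szego p (Suc (Suc m))
       + Polynomial.smult (1 - p ^ Suc m) (rogers_szego p M * (monom 1 1 * rogers_szego p m))"
      by (simp only: rogers_szego_rec distrib_left mult_smult_right)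
    thus ?thesis by (simp only: mult.left_commute[of "rogers_szego p M"])
  qed
  also have "[:1, 1:] * (rogers_szego p M * rogers_szego p (Suc m)) =
       (\<Sum>i\<le>Suc m. Polynomial.smult (r (Suc m) i) (Q i))
       + (\<Sum>i\<le>Suc m. Polynomial.smult ((1 - p ^ (M + Suc m - 2 * i)) * r (Suc m) i) (Q (Suc i)))"
    unfolding ge2 sum_distrib_left sum.distrib[symmetric] r_def[symmetric]
    by (intro sum.cong refl a) simp
  also have "Polynomial.smult (1 - p ^ Suc m) (monom 1 1 * (rogers_szego p M * rogers_szego p m)) =
       (\<Sum>i\<le>m. Polynomial.smult ((1 - p ^ Suc m) * r m i) (Q (Suc i)))"
    unfolding ge2 sum_distrib_left smult_sum_right r_def[symmetric] b smult_smult ..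
  also have "(\<Sum>i\<le>m. Polynomial.smult ((1 - p ^ Suc m) * r m i) (Q (Suc i))) =
     (\<Sum>i\<le>Suc m. Polynomial.smult ((1 - p ^ Suc m) * r m i) (Q (Suc i)))"
    by (simp add: r_def lin_coeff_eq_0)
  also have "(\<Sum>i\<le>Suc m. Polynomial.smult (r (Suc m) i) (Q i)) = (\<Sum>i\<le>Suc (Suc m). Polynomial.smult (r (Suc m) i) (Q i))"
    by (simp add: r_def lin_coeff_eq_0)
  also have "\<dots> = Q 0 + (\<Sum>i\<le>Suc m. Polynomial.smult (r (Suc m) (Suc i)) (Q (Suc i)))"
    by (subst sum.atMost_Suc_shift) (simp add: r_def)
  also have "\<dots> + (\<Sum>i\<le>Suc m. Polynomial.smult ((1 - p ^ (M + Suc m - 2 * i)) * r (Suc m) i) (Q (Suc i)))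
       - (\<Sum>i\<le>Suc m. Polynomial.smult ((1 - p ^ Suc m) * r m i) (Q (Suc i)))
     = Q 0 + (\<Sum>i\<le>Suc m. Polynomial.smult (r (Suc m) (Suc i) + (1 - p ^ (M + Suc m - 2 * i)) * r (Suc m) i
         - (1 - p ^ Suc m) * r m i) (Q (Suc i)))"
    unfolding smult_diff_left smult_add_left sum_subtractf sum.distrib by simp
  also have "\<dots> = Q 0 + (\<Sum>i\<le>Suc m. Polynomial.smult (r (Suc (Suc m)) (Suc i)) (Q (Suc i)))"
  proof (intro arg_cong2[of _ _ _ _ "(+)"] sum.cong refl)
    fix i assume i: "i \<in> {..Suc m}"
    show "Polynomial.smult (r (Suc m) (Suc i) + (1 - p ^ (M + Suc m - 2 * i)) * r (Suc m) i
         - (1 - p ^ Suc m) * r m i) (Q (Suc i)) = Polynomial.smult (r (Suc (Suc m)) (Suc i)) (Q (Suc i))"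
      using i lin_coeff_rec2[of i m M] by (cases "i \<le> M") (auto simp: r_def lin_coeff_eq_0)
  qed
  also have "\<dots> = (\<Sum>i\<le>Suc (Suc m). Polynomial.smult (r (Suc (Suc m)) i) (Q i))"
    by (subst (2) sum.atMost_Suc_shift) (simp add: r_def)
  finally show ?case by (simp add: Q_def r_def)
qed

section \<open>Inversion of the triangular system of Gaussian binomials\<close>

definition inv_coeff :: "nat \<Rightarrow> nat \<Rightarrow> real" where
  "inv_coeff e j = (-1) ^ j * p ^ (j choose 2) *
     (if e + j = 0 then 1 else gauss_binom p (e + j) j * (1 - p ^ (e + 2 * j)) / (1 - p ^ (e + j)))"

text \<open>For e = j = 0 the quotient in \<open>inv_coeff\<close> would be 0 / 0, which HOL
  evaluates to 0; the case distinction supplies the value 1 that the inversion requires.\<close>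

lemma inv_coeff_0 [simp]: "inv_coeff e 0 = 1"
  using one_minus_power_pos[of e] p01 by (cases "e = 0") (auto simp: inv_coeff_def binomial_eq_0)

text \<open>The orthogonality sum telescopes, and only its partial sums admit an induction. The
  closed form contains the factor 1 - p^(s-J), so it vanishes once J reaches s.\<close>

lemma inv_coeff_partial_sum:
  assumes "0 < s" "J \<le> s"
  shows "(\<Sum>j\<le>J. inv_coeff e j * gauss_binom p (e + 2 * s) (s - j)) =
    (-1) ^ J * p ^ (Suc J choose 2) * qpoch p (e + 2 * s) * qpoch p (e + J) * (1 - p ^ (s - J))
     / (qpoch p e * qpoch p J * qpoch p (s - J) * qpoch p (e + s + J) * (1 - p ^ s))"
  using assms(2)
proof (induction J)
  case 0
  have "e + 2 * s - s = e + s" by simp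
  thus ?case using qpoch_neq_0 one_minus_power_pos[of s] assms by (simp add: gauss_binom_def binomial_eq_0 add.commute)
next
  case (Suc J)
  define u where "u = s - Suc J"
  have u: "s - J = Suc u" "s = u + Suc J" "e + 2 * s - u = Suc (e + s + J)" using Suc.prems by (auto simp: u_def)
  have c: "p ^ (Suc (Suc J) choose 2) = p ^ (Suc J choose 2) * p ^ Suc J"
    by (simp add: numeral_2_eq_2 power_add)
  \<comment> \<open>\<open>E\<close> is the common factor of the old partial sum and the new term.
    The rest is the identity (1 - p^(J+1)) (1 - p^(e+s+J+1)) - (1 - p^(e+2J+2)) (1 - p^s) = -
    p^(J+1) (1 - p^(e+J+1)) (1 - p^(s-J-1)).\<close>
  define E where "E = (-1) ^ J * p ^ (Suc J choose 2) * qpoch p (e + 2 * s) * qpoch p (e + J)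
     / (qpoch p e * qpoch p (Suc J) * qpoch p u * qpoch p (Suc (e + s + J)) * (1 - p ^ s))"
  have n: "1 - p ^ s \<noteq> 0" "1 - p ^ Suc J \<noteq> 0" "1 - p ^ Suc u \<noteq> 0" "1 - p ^ Suc (e + s + J) \<noteq> 0" "1 - p ^ Suc (e + J) \<noteq> 0"
    using one_minus_power_pos[of s] one_minus_power_Suc_neq assms by (auto simp del: power_Suc)
  have "(\<Sum>j\<le>Suc J. inv_coeff e j * gauss_binom p (e + 2 * s) (s - j)) =
     (-1) ^ J * p ^ (Suc J choose 2) * qpoch p (e + 2 * s) * qpoch p (e + J) * (1 - p ^ Suc u)
       / (qpoch p e * qpoch p J * qpoch p (Suc u) * qpoch p (e + s + J) * (1 - p ^ s)) +
     inv_coeff e (Suc J) * gauss_binom p (e + 2 * s) u"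
    unfolding sum.atMost_Suc Suc.IH[OF Suc_leD[OF Suc.prems]] u(1) u_def[symmetric] ..
  also have "(-1) ^ J * p ^ (Suc J choose 2) * qpoch p (e + 2 * s) * qpoch p (e + J) * (1 - p ^ Suc u)
       / (qpoch p e * qpoch p J * qpoch p (Suc u) * qpoch p (e + s + J) * (1 - p ^ s)) =
     E * ((1 - p ^ Suc J) * (1 - p ^ Suc (e + s + J)))"
    unfolding E_def qpoch_Suc using n qpoch_neq_0 by (simp add: divide_simps del: power_Suc)
  also have "inv_coeff e (Suc J) * gauss_binom p (e + 2 * s) u = - E * ((1 - p ^ (e + 2 * Suc J)) * (1 - p ^ s))"
  proof -
    have "e + Suc J - Suc J = e" "u \<le> e + 2 * s" "e + Suc J = Suc (e + J)" using u by auto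
    thus ?thesis unfolding E_def inv_coeff_def gauss_binom_def u(3)
      using n qpoch_neq_0 by (simp add: divide_simps qpoch_Suc del: power_Suc)
  qed
  also have "E * ((1 - p ^ Suc J) * (1 - p ^ Suc (e + s + J))) + - E * ((1 - p ^ (e + 2 * Suc J)) * (1 - p ^ s)) =
      - E * (p ^ Suc J * ((1 - p ^ Suc (e + J)) * (1 - p ^ u)))"
  proof -
    have "(1 - p ^ Suc J) * (1 - p ^ Suc (e + s + J)) - (1 - p ^ (e + 2 * Suc J)) * (1 - p ^ s)
      = - (p ^ Suc J * ((1 - p ^ Suc (e + J)) * (1 - p ^ u)))"
      unfolding u(2) by (simp add: algebra_simps power_add mult_2_right)
    moreover have "E * x + - E * y = E * (x - y)" for x y by (simp add: algebra_simps)
    ultimately show ?thesis by (simp only: mult_minus_left mult_minus_right)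
  qed
  also have "\<dots> = (-1) ^ Suc J * p ^ (Suc (Suc J) choose 2) * qpoch p (e + 2 * s) * qpoch p (e + Suc J) * (1 - p ^ (s - Suc J))
     / (qpoch p e * qpoch p (Suc J) * qpoch p (s - Suc J) * qpoch p (e + s + Suc J) * (1 - p ^ s))"
    unfolding E_def c u_def[symmetric] by (simp add: qpoch_Suc del: power_Suc)
  finally show ?case .
qed

lemma inv_coeff_orthogonal:
  "(\<Sum>j\<le>s. inv_coeff e j * gauss_binom p (e + 2 * s) (s - j)) = (if s = 0 then 1 else 0)"
  using inv_coeff_partial_sum[of s s e] p01 by auto

text \<open>The numbers \<open>inv_coeff (n - 2 * k) j\<close> thus define a linear functional on
  the coefficients of t^k, ..., t^0 that singles out l = k among the polynomials t^l H_(n-2l). For l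
  <= k put s = k - l, so that n - 2 l = (n - 2 k) + 2 s, and use orthogonality; for l > k the
  coefficients read off are all 0.\<close>

lemma inv_coeff_rogers_szego:
  assumes "2 * k \<le> n" "2 * l \<le> n"
  shows "(\<Sum>j\<le>k. inv_coeff (n - 2 * k) j * coeff (monom 1 l * rogers_szego p (n - 2 * l)) (k - j))
     = (if l = k then 1 else 0)"
proof (cases "l \<le> k")
  case True
  define s where "s = k - l"
  have "(\<Sum>j\<le>k. inv_coeff (n - 2 * k) j * coeff (monom 1 l * rogers_szego p (n - 2 * l)) (k - j))
    = (\<Sum>j\<le>s. inv_coeff (n - 2 * k) j * gauss_binom p (n - 2 * k + 2 * s) (s - j))"
  proof (rule sum.mono_neutral_cong_right)
    show "\<forall>j\<in>{..k} - {..s}. inv_coeff (n - 2 * k) j * coeff (monom 1 l * rogers_szego p (n - 2 * l)) (k - j) = 0"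
      by (auto simp: coeff_monom_mult s_def)
  next
    fix j assume "j \<in> {..s}"
    moreover have "n - 2 * k + 2 * s = n - 2 * l" using True assms by (simp add: s_def)
    ultimately show "inv_coeff (n - 2 * k) j * coeff (monom 1 l * rogers_szego p (n - 2 * l)) (k - j)
       = inv_coeff (n - 2 * k) j * gauss_binom p (n - 2 * k + 2 * s) (s - j)"
      using True by (auto simp: coeff_monom_mult s_def add.commute)
  qed (use True in \<open>auto simp: s_def\<close>)
  also have "\<dots> = (if l = k then 1 else 0)" using True unfolding inv_coeff_orthogonal by (auto simp: s_def)
  finally show ?thesis .
next
  case False
  thus ?thesis by (intro sum.neutral[THEN trans]) (auto simp: coeff_monom_mult)
qed

end

section \<open>Square-zero matrices as lists of columns\<close>

definition supp_vecs :: "nat \<Rightarrow> (nat \<Rightarrow> 'a::zero) set" where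
  "supp_vecs n = {v. \<forall>i\<ge>n. v i = 0}"

text \<open>The product of the matrix with columns \<open>xs\<close> and the vector
  \<open>v\<close>. No height is fixed: with zero padding, the columns of a matrix remain literally
  the same functions when a further block enlarges the matrix.\<close>

definition comb :: "(nat \<Rightarrow> 'a::comm_ring) list \<Rightarrow> (nat \<Rightarrow> 'a) \<Rightarrow> nat \<Rightarrow> 'a" where
  "comb xs v = (\<lambda>i. \<Sum>j<length xs. v j * (xs ! j) i)"

definition colspan :: "(nat \<Rightarrow> 'a::comm_ring) list \<Rightarrow> (nat \<Rightarrow> 'a) set" where
  "colspan xs = range (comb xs)"

definition ker_vecs :: "(nat \<Rightarrow> 'a::comm_ring) list \<Rightarrow> (nat \<Rightarrow> 'a) set" where
  "ker_vecs xs = {v \<in> supp_vecs (length xs). comb xs v = (\<lambda>_. 0)}"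

lemma bij_betw_supp_vecs:
  "bij_betw (\<lambda>v. restrict v {..<n}) (supp_vecs n) ({..<n} \<rightarrow>\<^sub>E UNIV)"
proof (rule bij_betw_byWitness[where f' = "\<lambda>v i. if i < n then v i else 0"])
qed (auto simp: supp_vecs_def fun_eq_iff PiE_def extensional_def)

lemma finite_supp_vecs: "finite (supp_vecs n :: (nat \<Rightarrow> 'a::{zero, finite}) set)"
  using bij_betw_finite[OF bij_betw_supp_vecs[where n = n and 'a = 'a]] by (simp add: finite_PiE)

lemma card_supp_vecs: "card (supp_vecs n :: (nat \<Rightarrow> 'a::{zero, finite}) set) = CARD('a) ^ n"
  using bij_betw_same_card[OF bij_betw_supp_vecs[where n = n and 'a = 'a]] by (simp add: card_PiE)

lemma comb_diff: "comb xs (\<lambda>i. u i - v i) = (\<lambda>i. comb xs u i - comb xs v i)"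
  by (simp add: comb_def fun_eq_iff algebra_simps sum_subtractf)

lemma comb_add: "comb xs (\<lambda>i. u i + v i) = (\<lambda>i. comb xs u i + comb xs v i)"
  by (simp add: comb_def fun_eq_iff algebra_simps sum.distrib)

lemma comb_scale: "comb xs (\<lambda>i. c * v i) = (\<lambda>i. c * comb xs v i)"
  by (simp add: comb_def fun_eq_iff algebra_simps sum_distrib_left)

lemma comb_cong: "(\<And>j. j < length xs \<Longrightarrow> u j = v j) \<Longrightarrow> comb xs u = comb xs v"
  by (simp add: comb_def)

lemma comb_append:
  "comb (xs @ ys) v = (\<lambda>i. comb xs v i + comb ys (\<lambda>j. v (length xs + j)) i)"
proof
  fix i
  have "(\<Sum>j<length xs + k. v j * ((xs @ ys) ! j) i) =
      (\<Sum>j<length xs. v j * (xs ! j) i) + (\<Sum>j<k. v (length xs + j) * (ys ! j) i)" for k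
    by (induction k) (simp_all add: add.assoc nth_append)
  thus "comb (xs @ ys) v i = comb xs v i + comb ys (\<lambda>j. v (length xs + j)) i"
    by (simp add: comb_def)
qed

lemma comb_append_supp: "v \<in> supp_vecs (length xs) \<Longrightarrow> comb (xs @ ys) v = comb xs v"
  by (simp add: comb_append) (simp add: comb_def supp_vecs_def)

lemma colspan_eq_image: "colspan xs = comb xs ` supp_vecs (length xs)"
proof -
  have "comb xs v \<in> comb xs ` supp_vecs (length xs)" for v
  proof (rule image_eqI)
    show "comb xs v = comb xs (\<lambda>i. if i < length xs then v i else 0)"
      by (rule comb_cong) simp
  qed (simp add: supp_vecs_def)
  thus ?thesis unfolding colspan_def by blast
qed

lemma finite_colspan: "finite (colspan (xs :: (nat \<Rightarrow> 'a::{comm_ring, finite}) list))"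
  by (simp add: colspan_eq_image finite_supp_vecs)

lemma colspan_add: "u \<in> colspan xs \<Longrightarrow> v \<in> colspan xs \<Longrightarrow> (\<lambda>i. u i + v i) \<in> colspan xs"
  by (auto simp: colspan_def simp flip: comb_add)

lemma colspan_diff: "u \<in> colspan xs \<Longrightarrow> v \<in> colspan xs \<Longrightarrow> (\<lambda>i. u i - v i) \<in> colspan xs"
  by (auto simp: colspan_def simp flip: comb_diff)

lemma colspan_scale: "u \<in> colspan xs \<Longrightarrow> (\<lambda>i. c * u i) \<in> colspan xs"
  by (auto simp: colspan_def simp flip: comb_scale)

lemma colspan_Nil: "colspan [] = {\<lambda>_. 0}"
  by (auto simp: colspan_def comb_def)

lemma colspan_snoc:
  "colspan (xs @ [y]) = (\<lambda>(u, c) i. u i + c * y i) ` (colspan xs \<times> UNIV)"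
proof (intro equalityI subsetI)
  fix w assume "w \<in> colspan (xs @ [y])"
  thus "w \<in> (\<lambda>(u, c) i. u i + c * y i) ` (colspan xs \<times> UNIV)"
    unfolding colspan_def comb_append comb_def[of "[y]"] by (auto simp: case_prod_unfold image_iff)
next
  fix w assume "w \<in> (\<lambda>(u, c) i. u i + c * y i) ` (colspan xs \<times> UNIV)"
  then obtain v c where w: "w = (\<lambda>i. comb xs v i + c * y i)" by (auto simp: colspan_def)
  have "comb xs v = comb xs (\<lambda>j. if j < length xs then v j else c)"
    by (rule comb_cong) simp
  hence "w = comb (xs @ [y]) (\<lambda>j. if j < length xs then v j else c)"
    by (simp add: w comb_append comb_def[of "[y]"])
  thus "w \<in> colspan (xs @ [y])" by (simp add: colspan_def)
qed

lemma colspan_snoc_in: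
  assumes "y \<in> colspan xs"
  shows "colspan (xs @ [y]) = colspan xs"
proof (intro equalityI subsetI)
  fix w assume "w \<in> colspan (xs @ [y])"
  thus "w \<in> colspan xs" using assms by (auto simp: colspan_snoc intro!: colspan_add colspan_scale)
next
  fix w assume "w \<in> colspan xs"
  thus "w \<in> colspan (xs @ [y])" by (auto simp: colspan_snoc intro!: image_eqI[of _ _ "(w, 0)"])
qed

lemma card_colspan_snoc_notin:
  fixes y :: "nat \<Rightarrow> 'a::{field, finite}"
  assumes "y \<notin> colspan xs"
  shows "card (colspan (xs @ [y])) = CARD('a) * card (colspan xs)"
proof -
  have "inj_on (\<lambda>(u, c) i. u i + c * y i) (colspan xs \<times> UNIV)"
  proof (rule inj_onI, clarify)
    fix u c v d assume uv: "u \<in> colspan xs" "v \<in> colspan xs"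
      and eq: "(\<lambda>i. u i + c * y i) = (\<lambda>i. v i + d * y i)"
    have e: "u i - v i = (d - c) * y i" for i using fun_cong[OF eq, of i] by (simp add: algebra_simps)
    have "c = d"
    proof (rule ccontr)
      assume "c \<noteq> d"
      hence "y = (\<lambda>i. inverse (d - c) * (u i - v i))" by (simp add: e fun_eq_iff)
      also have "\<dots> \<in> colspan xs" using uv by (intro colspan_scale colspan_diff)
      finally show False using assms by simp
    qed
    thus "u = v \<and> c = d" using e by (auto simp: fun_eq_iff)
  qed
  thus ?thesis by (simp add: colspan_snoc card_image card_cartesian_product mult.commute)
qed

lemma CARD_field_gt_1: "1 < CARD('a::{field, finite})"
proof -
  have "card {0, 1 :: 'a} \<le> CARD('a)" by (intro card_mono) auto
  thus ?thesis by simp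
qed

section \<open>Rank, and the number of ways to append columns\<close>

lemma ex_card_colspan: "\<exists>k. card (colspan (xs :: (nat \<Rightarrow> 'a::{field, finite}) list)) = CARD('a) ^ k"
proof (induction xs rule: rev_induct)
  case Nil
  show ?case by (simp add: colspan_Nil exI[of _ 0])
next
  case (snoc y xs)
  then obtain k where "card (colspan xs) = CARD('a) ^ k" by blast
  hence "card (colspan (xs @ [y])) = CARD('a) ^ k \<or> card (colspan (xs @ [y])) = CARD('a) ^ Suc k"
    using colspan_snoc_in[of y xs] card_colspan_snoc_notin[of y xs] by (cases "y \<in> colspan xs") auto
  thus ?case by blast
qed

text \<open>The rank is read off from the size of the column space, so no basis has to be chosen: a
  new column either leaves that size alone or multiplies it by the size of the field.\<close>

definition col_rank :: "(nat \<Rightarrow> 'a::{field, finite}) list \<Rightarrow> nat" where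
  "col_rank xs = (SOME k. card (colspan xs) = CARD('a) ^ k)"

lemma card_colspan: "card (colspan (xs :: (nat \<Rightarrow> 'a::{field, finite}) list)) = CARD('a) ^ col_rank xs"
  unfolding col_rank_def by (rule someI_ex[OF ex_card_colspan])

lemma col_rank_eqI: "card (colspan (xs :: (nat \<Rightarrow> 'a::{field, finite}) list)) = CARD('a) ^ k \<Longrightarrow> col_rank xs = k"
  using card_colspan[of xs] CARD_field_gt_1[where 'a = 'a] by simp

lemma col_rank_Nil [simp]: "col_rank [] = 0"
  by (rule col_rank_eqI) (simp add: colspan_Nil)

lemma col_rank_snoc:
  fixes xs :: "(nat \<Rightarrow> 'a::{field, finite}) list"
  shows "col_rank (xs @ [y]) = (if y \<in> colspan xs then col_rank xs else Suc (col_rank xs))"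
proof (rule col_rank_eqI, cases "y \<in> colspan xs")
  case True
  thus "card (colspan (xs @ [y])) = CARD('a) ^ (if y \<in> colspan xs then col_rank xs else Suc (col_rank xs))"
    by (simp add: colspan_snoc_in card_colspan)
next
  case False
  thus "card (colspan (xs @ [y])) = CARD('a) ^ (if y \<in> colspan xs then col_rank xs else Suc (col_rank xs))"
    using card_colspan[of xs] by (simp add: card_colspan_snoc_notin)
qed

text \<open>Rank-nullity in counting form: the fibres of \<open>comb xs\<close> over the column
  space are translates of the kernel.\<close>

lemma card_ker_vecs:
  fixes xs :: "(nat \<Rightarrow> 'a::{field, finite}) list"
  shows "card (ker_vecs xs) * card (colspan xs) = CARD('a) ^ length xs"
proof -
  let ?V = "supp_vecs (length xs) :: (nat \<Rightarrow> 'a) set"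
  have "card {v \<in> ?V. comb xs v = w} = card (ker_vecs xs)" if w: "w \<in> colspan xs" for w
  proof -
    obtain u where u: "u \<in> ?V" "w = comb xs u" using w by (auto simp: colspan_eq_image)
    have "bij_betw (\<lambda>v i. v i - u i) {v \<in> ?V. comb xs v = w} (ker_vecs xs)"
      by (rule bij_betw_byWitness[where f' = "\<lambda>v i. v i + u i"])
         (use u in \<open>auto simp: ker_vecs_def comb_diff comb_add supp_vecs_def\<close>)
    thus ?thesis by (rule bij_betw_same_card)
  qed
  hence "(\<Sum>w\<in>colspan xs. card {v \<in> ?V. comb xs v = w}) = card (colspan xs) * card (ker_vecs xs)"
    by simp
  also have "(\<Sum>w\<in>colspan xs. card {v \<in> ?V. comb xs v = w}) = card ?V"
    using sum.group[of ?V "colspan xs" "comb xs" "\<lambda>_. 1::nat"]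
    by (simp add: finite_supp_vecs finite_colspan colspan_eq_image)
  finally show ?thesis by (simp add: card_supp_vecs mult.commute)
qed

lemma colspan_append_subset_ker:
  assumes "colspan xs \<subseteq> ker_vecs zs" "set ys \<subseteq> ker_vecs zs"
  shows "colspan (xs @ ys) \<subseteq> ker_vecs zs"
  using assms(2)
proof (induction ys rule: rev_induct)
  case (snoc y ys)
  hence "colspan (xs @ ys) \<subseteq> ker_vecs zs" "y \<in> ker_vecs zs" by auto
  moreover have "(\<lambda>i. u i + c * v i) \<in> ker_vecs zs" if "u \<in> ker_vecs zs" "v \<in> ker_vecs zs" for u v c
    using that by (auto simp: ker_vecs_def comb_add comb_scale supp_vecs_def)
  ultimately have "colspan ((xs @ ys) @ [y]) \<subseteq> ker_vecs zs"
    unfolding colspan_snoc[of "xs @ ys"] by auto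
  thus ?case by simp
qed (use assms(1) in simp)

text \<open>The number of M x m matrices of rank i over a field with q elements, built column by
  column: a column inside a span of dimension i + 1 can be chosen in q^(i+1) ways, one outside a
  span of dimension i in q^M - q^i ways.\<close>

fun rank_count :: "real \<Rightarrow> nat \<Rightarrow> nat \<Rightarrow> nat \<Rightarrow> real" where
  "rank_count q M 0 i = (if i = 0 then 1 else 0)"
| "rank_count q M (Suc m) 0 = rank_count q M m 0"
| "rank_count q M (Suc m) (Suc i) =
     q ^ Suc i * rank_count q M m (Suc i) + (q ^ M - q ^ i) * rank_count q M m i"

lemma rank_count_eq_0: "m < i \<Longrightarrow> rank_count q M m i = 0"
  by (induction q M m i rule: rank_count.induct) auto

definition lists_over :: "'b set \<Rightarrow> nat \<Rightarrow> 'b list set" where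
  "lists_over K m = {ys. set ys \<subseteq> K \<and> length ys = m}"

lemma lists_over_0 [simp]: "lists_over K 0 = {[]}"
  by (auto simp: lists_over_def)

lemma bij_betw_lists_over_Suc:
  "bij_betw (\<lambda>(ys, y). ys @ [y]) (lists_over K m \<times> K) (lists_over K (Suc m))"
proof (rule bij_betw_imageI)
  show "inj_on (\<lambda>(ys, y). ys @ [y]) (lists_over K m \<times> K)" by (auto simp: inj_on_def)
  have "zs \<in> (\<lambda>(ys, y). ys @ [y]) ` (lists_over K m \<times> K)" if "zs \<in> lists_over K (Suc m)" for zs
  proof (cases zs rule: rev_cases)
    case (snoc ys y)
    with that show ?thesis by (intro image_eqI[of _ _ "(ys, y)"]) (auto simp: lists_over_def)
  qed (use that in \<open>simp add: lists_over_def\<close>)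
  thus "(\<lambda>(ys, y). ys @ [y]) ` (lists_over K m \<times> K) = lists_over K (Suc m)"
    by (auto simp: lists_over_def)
qed

lemma finite_lists_over: "finite K \<Longrightarrow> finite (lists_over K m)"
  unfolding lists_over_def by (rule finite_lists_length_eq)

lemma finite_ker_vecs: "finite (ker_vecs (xs :: (nat \<Rightarrow> 'a::{comm_ring, finite}) list))"
  by (rule finite_subset[OF _ finite_supp_vecs]) (auto simp: ker_vecs_def)

text \<open>The kernel has dimension M + l and contains the column space, of dimension l. Modulo
  that space the new columns form an M x m matrix whose rank is the increase in rank, and each such
  matrix lifts in q^(l m) ways. The induction appends one column, which replaces f(r) by q^r f(r) +
  (q^(M+l) - q^r) f(r+1); hence \<open>f\<close> has to be arbitrary.\<close>

lemma sum_col_rank_append: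
  fixes xs :: "(nat \<Rightarrow> 'a::{field, finite}) list" and f :: "nat \<Rightarrow> real"
  defines "q \<equiv> real CARD('a)" and "l \<equiv> col_rank xs"
  assumes sub: "colspan xs \<subseteq> ker_vecs xs" and len: "length xs = M + 2 * l"
  shows "(\<Sum>ys\<in>lists_over (ker_vecs xs) m. f (col_rank (xs @ ys))) =
     (\<Sum>i\<le>m. (q ^ (l * m) * rank_count q M m i) * f (l + i))"
proof (induction m arbitrary: f)
  case 0
  show ?case by (simp add: l_def)
next
  case (Suc m)
  let ?K = "ker_vecs xs"
  have q1: "1 < q" using CARD_field_gt_1[where 'a = 'a] by (simp add: q_def)
  have cK: "real (card ?K) = q ^ (M + l)"
  proof -
    have "real (card ?K) * q ^ l = q ^ (M + l) * q ^ l"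
      using arg_cong[OF card_ker_vecs[of xs], of real] len
      by (simp add: card_colspan q_def l_def mult_2 add.assoc flip: power_add)
    thus ?thesis using q1 by simp
  qed
  have "(\<Sum>ys\<in>lists_over ?K (Suc m). f (col_rank (xs @ ys)))
    = (\<Sum>(ys, y)\<in>lists_over ?K m \<times> ?K. f (col_rank ((xs @ ys) @ [y])))"
    by (subst sum.reindex_bij_betw[OF bij_betw_lists_over_Suc, symmetric])
       (simp add: case_prod_unfold)
  also have "\<dots> = (\<Sum>ys\<in>lists_over ?K m. \<Sum>y\<in>?K. f (col_rank ((xs @ ys) @ [y])))"
    by (simp add: sum.cartesian_product finite_lists_over finite_ker_vecs)
  also have "\<dots> = (\<Sum>ys\<in>lists_over ?K m. q ^ col_rank (xs @ ys) * f (col_rank (xs @ ys))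
      + (q ^ (M + l) - q ^ col_rank (xs @ ys)) * f (Suc (col_rank (xs @ ys))))"
  proof (rule sum.cong[OF refl])
    fix ys assume "ys \<in> lists_over ?K m"
    hence U: "colspan (xs @ ys) \<subseteq> ?K" by (intro colspan_append_subset_ker sub) (simp add: lists_over_def)
    define U where "U = colspan (xs @ ys)"
    define r where "r = col_rank (xs @ ys)"
    have cU: "real (card U) = q ^ r" by (simp add: U_def r_def q_def card_colspan)
    have "real (card (?K - U)) = real (card ?K) - real (card U)"
      using U by (simp add: U_def card_Diff_subset finite_colspan card_mono finite_ker_vecs of_nat_diff)
    hence cKU: "real (card (?K - U)) = q ^ (M + l) - q ^ r" using cU cK by simp
    have "(\<Sum>y\<in>?K. f (col_rank ((xs @ ys) @ [y]))) =
        (\<Sum>y\<in>?K - U. f (col_rank ((xs @ ys) @ [y]))) + (\<Sum>y\<in>U. f (col_rank ((xs @ ys) @ [y])))"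
      using U by (intro sum.subset_diff finite_ker_vecs) (simp add: U_def)
    also have "\<dots> = (\<Sum>y\<in>?K - U. f (Suc r)) + (\<Sum>y\<in>U. f r)"
      unfolding col_rank_snoc by (intro arg_cong2[of _ _ _ _ "(+)"] sum.cong refl) (auto simp: U_def r_def)
    also have "\<dots> = q ^ r * f r + (q ^ (M + l) - q ^ r) * f (Suc r)"
      by (simp add: cU cKU)
    finally show "(\<Sum>y\<in>?K. f (col_rank ((xs @ ys) @ [y]))) = q ^ r * f r + (q ^ (M + l) - q ^ r) * f (Suc r)" .
  qed
  also have "\<dots> = (\<Sum>i\<le>m. (q ^ (l * m) * rank_count q M m i) *
      (q ^ (l + i) * f (l + i) + (q ^ (M + l) - q ^ (l + i)) * f (Suc (l + i))))"
    by (rule Suc.IH)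
  also have "\<dots> = (\<Sum>i\<le>m. (q ^ (l * Suc m) * (q ^ i * rank_count q M m i)) * f (l + i)) +
     (\<Sum>i\<le>m. (q ^ (l * Suc m) * ((q ^ M - q ^ i) * rank_count q M m i)) * f (l + Suc i))"
    by (simp add: power_add algebra_simps flip: sum.distrib)
  also have "(\<Sum>i\<le>m. (q ^ (l * Suc m) * (q ^ i * rank_count q M m i)) * f (l + i)) =
     (\<Sum>i\<le>Suc m. (q ^ (l * Suc m) * (q ^ i * rank_count q M m i)) * f (l + i))"
    by (simp add: rank_count_eq_0)
  also have "\<dots> = (q ^ (l * Suc m) * rank_count q M m 0) * f l +
     (\<Sum>i\<le>m. (q ^ (l * Suc m) * (q ^ Suc i * rank_count q M m (Suc i))) * f (l + Suc i))"
    by (subst sum.atMost_Suc_shift) simp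
  also have "\<dots> + (\<Sum>i\<le>m. (q ^ (l * Suc m) * ((q ^ M - q ^ i) * rank_count q M m i)) * f (l + Suc i))
     = (q ^ (l * Suc m) * rank_count q M (Suc m) 0) * f (l + 0) +
        (\<Sum>i\<le>m. (q ^ (l * Suc m) * rank_count q M (Suc m) (Suc i)) * f (l + Suc i))"
    by (simp add: algebra_simps flip: sum.distrib)
  also have "\<dots> = (\<Sum>i\<le>Suc m. (q ^ (l * Suc m) * rank_count q M (Suc m) i) * f (l + i))"
    by (rule sum.atMost_Suc_shift[symmetric])
  finally show ?case .
qed


lemma rank_count_eq_0': "M < i \<Longrightarrow> rank_count q M m i = 0"
  by (induction q M m i rule: rank_count.induct) (auto simp: less_Suc_eq)

text \<open>Removing the leading power of q from the number of matrices of rank i leaves exactly the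
  linearization coefficient in base 1/q. The recurrences in m agree because q^(M+m-k) p^(m-k) (1 -
  p^(M-k)) = q^M - q^k with p = 1/q.\<close>

lemma rank_count_eq_lin_coeff:
  assumes "1 < q" "i \<le> M"
  shows "rank_count q M m i = lin_coeff (1 / q) M m i * q ^ (i * (M + m - i))"
  using assms(2)
proof (induction m arbitrary: i)
  case 0
  show ?case using assms by (cases i) (auto simp: lin_coeff_eq_0)
next
  case (Suc m)
  have p: "0 < 1 / q" "1 / q < 1" using assms by auto
  show ?case
  proof (cases i)
    case 0
    thus ?thesis using Suc.IH[of 0] p by simp
  next
    case (Suc k)
    define w where "w = M + m - Suc k"
    have w: "M + m - k = Suc w" "M + Suc m - Suc k = Suc w" using Suc Suc.prems by (auto simp: w_def)
    have "rank_count q M (Suc m) i = lin_coeff (1 / q) M m (Suc k) * q ^ (Suc k * Suc w)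
       + (q ^ M - q ^ k) * (lin_coeff (1 / q) M m k * q ^ (k * Suc w))"
      using Suc.IH[of "Suc k"] Suc.IH[of k] Suc Suc.prems by (simp add: w flip: w_def) (simp add: power_add)
    also have "(q ^ M - q ^ k) * (lin_coeff (1 / q) M m k * q ^ (k * Suc w)) =
       (1 / q) ^ (m - k) * (1 - (1 / q) ^ (M - k)) * lin_coeff (1 / q) M m k * q ^ (Suc k * Suc w)"
    proof (cases "k \<le> m")
      case True
      have "Suc w = (m - k) + (M - k) + k" "M = (M - k) + k" using True Suc Suc.prems by (auto simp: w_def)
      hence e: "q ^ Suc w = q ^ (m - k) * q ^ (M - k) * q ^ k" "q ^ M = q ^ (M - k) * q ^ k"
        by (metis power_add)+
      have eq1: "(1 / q) ^ (m - k) * (1 - (1 / q) ^ (M - k)) * q ^ Suc w = q ^ M - q ^ k"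
        unfolding e using assms by (simp add: power_divide field_simps)
      have eq2: "q ^ (Suc k * Suc w) = q ^ Suc w * q ^ (k * Suc w)"
        by (simp only: mult_Suc power_add)
      show ?thesis unfolding eq2 eq1[symmetric] by (simp only: mult_ac)
    qed (simp add: lin_coeff_eq_0[OF p])
    finally show ?thesis unfolding Suc w lin_coeff_rec[OF p] by (simp only: algebra_simps)
  qed
qed

section \<open>Appending a diagonal block\<close>

lemma block_index_append_left:
  assumes "i < sum_list lam"
  shows "block_index (lam @ [m]) i = block_index lam i"
proof -
  have "i < sum_list (take (Suc r) (lam @ [m])) \<longleftrightarrow> i < sum_list (take (Suc r) lam)" for r
    using assms by (cases "r < length lam") (auto simp: Suc_le_eq)
  thus ?thesis by (simp add: block_index_def)
qed

lemma sum_list_take_le: "sum_list (take r lam) \<le> (sum_list lam :: nat)"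
  by (metis append_take_drop_id le_add1 sum_list_append)

lemma block_index_append_right:
  assumes "sum_list lam \<le> i" "i < sum_list lam + m"
  shows "block_index (lam @ [m]) i = length lam"
  unfolding block_index_def
proof (rule Least_equality)
  show "i < sum_list (take (Suc (length lam)) (lam @ [m]))" using assms by simp
next
  fix r assume r: "i < sum_list (take (Suc r) (lam @ [m]))"
  show "length lam \<le> r"
  proof (rule ccontr)
    assume "\<not> length lam \<le> r"
    thus False using r sum_list_take_le[of "Suc r" lam] assms by simp
  qed
qed

lemma block_index_less:
  assumes "i < sum_list lam"
  shows "block_index lam i < length lam"
proof -
  have "lam \<noteq> []" using assms by auto
  hence "block_index lam i \<le> length lam - 1"
    using assms unfolding block_index_def by (intro Least_le) simp
  thus ?thesis using \<open>lam \<noteq> []\<close> by (cases lam) auto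
qed

text \<open>Column lists of the square-zero matrices in the nilradical, with X^2 = 0 imposed column
  by column. The row index \<open>i\<close> is unbounded on purpose: beyond the size of the matrix
  the premise holds vacuously and forces the zero padding.\<close>

definition nil_cols :: "nat list \<Rightarrow> (nat \<Rightarrow> 'a::comm_ring) list set" where
  "nil_cols lam = {xs. length xs = sum_list lam \<and> (\<forall>j<sum_list lam.
     (\<forall>i. (i < sum_list lam \<longrightarrow> \<not> block_index lam i < block_index lam j) \<longrightarrow> (xs ! j) i = 0)
     \<and> comb xs (xs ! j) = (\<lambda>_. 0))}"

lemma nil_cols_Nil: "nil_cols [] = {[]}"
  by (auto simp: nil_cols_def)

lemma nil_cols_subset_supp:
  assumes "xs \<in> nil_cols lam"
  shows "set xs \<subseteq> supp_vecs (sum_list lam)"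
proof
  fix x assume "x \<in> set xs"
  then obtain j where "j < length xs" "x = xs ! j" by (auto simp: in_set_conv_nth)
  thus "x \<in> supp_vecs (sum_list lam)" using assms by (auto simp: nil_cols_def supp_vecs_def)
qed

lemma finite_nil_cols: "finite (nil_cols lam :: (nat \<Rightarrow> 'a::{comm_ring, finite}) list set)"
proof (rule finite_subset)
  show "nil_cols lam \<subseteq> lists_over (supp_vecs (sum_list lam) :: (nat \<Rightarrow> 'a) set) (sum_list lam)"
    using nil_cols_subset_supp by (auto simp: lists_over_def nil_cols_def)
qed (intro finite_lists_over finite_supp_vecs)

lemma nil_cols_colspan:
  assumes "xs \<in> nil_cols lam"
  shows "colspan xs \<subseteq> ker_vecs xs"
proof -
  have "set xs \<subseteq> ker_vecs xs"
    using nil_cols_subset_supp[OF assms] assms by (auto simp: ker_vecs_def nil_cols_def in_set_conv_nth)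
  moreover have "(\<lambda>_. 0) \<in> ker_vecs xs" by (auto simp: ker_vecs_def supp_vecs_def comb_def)
  ultimately show ?thesis using colspan_append_subset_ker[of "[]" xs xs] by (simp add: colspan_Nil)
qed

text \<open>X^2 = 0 puts the column space into the kernel, so r <= n - r by rank-nullity.\<close>

lemma nil_cols_rank:
  fixes xs :: "(nat \<Rightarrow> 'a::{field, finite}) list"
  assumes "xs \<in> nil_cols lam"
  shows "2 * col_rank xs \<le> sum_list lam"
proof -
  have "card (colspan xs) * card (colspan xs) \<le> card (ker_vecs xs) * card (colspan xs)"
    using nil_cols_colspan[OF assms] by (intro mult_right_mono card_mono finite_ker_vecs) auto
  hence "CARD('a) ^ (2 * col_rank xs) \<le> CARD('a) ^ length xs"
    unfolding card_ker_vecs[unfolded card_colspan] card_colspan by (simp add: mult_2 power_add)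
  hence "2 * col_rank xs \<le> length xs"
    by (rule power_le_imp_le_exp[OF CARD_field_gt_1[where 'a = 'a]])
  thus ?thesis using assms by (simp add: nil_cols_def)
qed

text \<open>A strictly block upper triangular matrix has zero rows in its last block. So every
  column, old or new, is supported on the first \<open>sum_list lam\<close> coordinates, and its
  product with the whole matrix involves the columns \<open>xs\<close> only. For a new column all
  conditions together say that it lies in the kernel of \<open>xs\<close>.\<close>

lemma nil_cols_snoc:
  "nil_cols (lam @ [m]) = (\<lambda>(xs, ys). xs @ ys) ` (SIGMA xs:nil_cols lam. lists_over (ker_vecs xs) m)"
  (is "?L = ?R")
proof (intro equalityI subsetI)
  let ?n = "sum_list lam"
  fix zs :: "(nat \<Rightarrow> 'a) list" assume zs: "zs \<in> ?L"
  define xs ys where "xs = take ?n zs" and "ys = drop ?n zs"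
  have len: "length xs = ?n" "length ys = m" and zs_eq: "zs = xs @ ys" using zs
    by (auto simp: nil_cols_def xs_def ys_def)
  have z0: "(zs ! j) i = 0" if "j < ?n + m" "i < ?n + m \<Longrightarrow> \<not> block_index (lam @ [m]) i < block_index (lam @ [m]) j" for i j
    using zs that by (auto simp: nil_cols_def)
  have c0: "comb zs (zs ! j) = (\<lambda>_. 0)" if "j < ?n + m" for j
    using zs that by (auto simp: nil_cols_def)
  have supp: "zs ! j \<in> supp_vecs ?n" if "j < ?n + m" for j
  proof -
    have "(zs ! j) i = 0" if "?n \<le> i" for i
    proof (rule z0[OF \<open>j < ?n + m\<close>])
      assume "i < ?n + m"
      moreover have "block_index (lam @ [m]) j < Suc (length lam)"
        using block_index_less[of j "lam @ [m]"] \<open>j < ?n + m\<close> by simp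
      ultimately show "\<not> block_index (lam @ [m]) i < block_index (lam @ [m]) j"
        using block_index_append_right[of lam i m] that by simp
    qed
    thus ?thesis by (simp add: supp_vecs_def)
  qed
  have c0': "comb xs (zs ! j) = (\<lambda>_. 0)" if "j < ?n + m" for j
    using c0[OF that] supp[OF that] by (simp add: zs_eq comb_append_supp len)
  have "xs \<in> nil_cols lam"
    unfolding nil_cols_def
  proof (intro CollectI conjI allI impI)
    fix j i assume j: "j < ?n" and i: "i < ?n \<longrightarrow> \<not> block_index lam i < block_index lam j"
    have "(zs ! j) i = 0"
    proof (cases "i < ?n")
      case True
      thus ?thesis using i j by (intro z0) (auto simp: block_index_append_left)
    next
      case False
      thus ?thesis using supp[of j] j by (simp add: supp_vecs_def)
    qed
    thus "(xs ! j) i = 0" using j by (simp add: zs_eq nth_append len)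
  next
    fix j assume j: "j < ?n"
    thus "comb xs (xs ! j) = (\<lambda>_. 0)" using c0'[of j] by (simp add: zs_eq nth_append len)
  qed (simp add: len)
  moreover have "ys \<in> lists_over (ker_vecs xs) m"
  proof -
    have "ys ! j \<in> ker_vecs xs" if "j < m" for j
      using supp[of "?n + j"] c0'[of "?n + j"] that by (simp add: ker_vecs_def zs_eq nth_append len)
    thus ?thesis by (auto simp: lists_over_def len in_set_conv_nth)
  qed
  ultimately show "zs \<in> ?R" unfolding zs_eq by force
next
  let ?n = "sum_list lam"
  fix zs :: "(nat \<Rightarrow> 'a) list" assume "zs \<in> ?R"
  then obtain xs ys where zs_eq: "zs = xs @ ys" and xs: "xs \<in> nil_cols lam" and ys: "ys \<in> lists_over (ker_vecs xs) m"
    by auto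
  have len: "length xs = ?n" "length ys = m" using xs ys by (auto simp: nil_cols_def lists_over_def)
  have K: "zs ! j \<in> ker_vecs xs" if "j < ?n + m" for j
  proof -
    have "zs ! j \<in> set (xs @ ys)" using that by (simp add: zs_eq len del: set_append)
    moreover have "set xs \<subseteq> ker_vecs xs"
      using nil_cols_subset_supp[OF xs] xs by (auto simp: ker_vecs_def nil_cols_def in_set_conv_nth)
    ultimately show ?thesis using ys by (auto simp: lists_over_def)
  qed
  show "zs \<in> ?L"
    unfolding nil_cols_def
  proof (intro CollectI conjI allI impI)
    show "length zs = sum_list (lam @ [m])" by (simp add: zs_eq len)
  next
    fix j assume "j < sum_list (lam @ [m])"
    thus "comb zs (zs ! j) = (\<lambda>_. 0)" using K[of j]
      by (simp add: ker_vecs_def) (simp add: zs_eq comb_append_supp)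
  next
    fix j i assume j: "j < sum_list (lam @ [m])" and
      i: "i < sum_list (lam @ [m]) \<longrightarrow> \<not> block_index (lam @ [m]) i < block_index (lam @ [m]) j"
    show "(zs ! j) i = 0"
    proof (cases "i < ?n")
      case False
      thus ?thesis using K[of j] j by (simp add: ker_vecs_def supp_vecs_def len)
    next
      case i': True
      have bi: "block_index (lam @ [m]) i < length lam"
        using i' by (simp add: block_index_append_left block_index_less)
      have jn: "j < ?n"
      proof (rule ccontr)
        assume "\<not> j < ?n"
        thus False using i i' j bi block_index_append_right[of lam j m] by simp
      qed
      hence "\<not> block_index lam i < block_index lam j" using i i' by (simp add: block_index_append_left)
      thus ?thesis using xs jn by (simp add: nil_cols_def zs_eq nth_append len)
    qed
  qed
qed

lemma sum_nil_cols:
  fixes lam :: "nat list"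
  defines "p \<equiv> 1 / real CARD('a::{field, finite})" and "n \<equiv> sum_list lam"
  shows "(\<Sum>xs\<in>(nil_cols lam :: (nat \<Rightarrow> 'a) list set).
      Polynomial.smult (p ^ (col_rank xs * (n - col_rank xs)))
        (monom 1 (col_rank xs) * rogers_szego p (n - 2 * col_rank xs)))
    = prod_list (map (rogers_szego p) lam)"
  unfolding n_def
proof (induction lam rule: rev_induct)
  case Nil
  show ?case using CARD_field_gt_1[where 'a = 'a] by (simp add: nil_cols_Nil rogers_szego_0 p_def)
next
  case (snoc m lam)
  define q where "q = real CARD('a)"
  have q1: "1 < q" using CARD_field_gt_1[where 'a = 'a] by (simp add: q_def)
  have p: "0 < p" "p < 1" and pq: "p = 1 / q" using q1 by (auto simp: p_def q_def)
  let ?n = "sum_list lam"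
  define F where "F n k = Polynomial.smult (p ^ (k * (n - k))) (monom 1 k * rogers_szego p (n - 2 * k))" for n k
  have inner: "(\<Sum>ys\<in>lists_over (ker_vecs xs) m. F (?n + m) (col_rank (xs @ ys))) =
      F ?n (col_rank xs) * rogers_szego p m" if xs: "xs \<in> nil_cols lam" for xs :: "(nat \<Rightarrow> 'a) list"
  proof -
    define l M where "l = col_rank xs" and "M = ?n - 2 * l"
    have n: "?n = M + 2 * l" using nil_cols_rank[OF xs] by (simp add: M_def l_def)
    hence len: "length xs = M + 2 * col_rank xs" using xs by (simp add: l_def nil_cols_def)
    have "(\<Sum>ys\<in>lists_over (ker_vecs xs) m. F (?n + m) (col_rank (xs @ ys))) =
        (\<Sum>i\<le>m. Polynomial.smult (q ^ (l * m) * rank_count q M m i) (F (?n + m) (l + i)))"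
    \<comment> \<open>\<open>sum_col_rank_append\<close> concerns real-valued functions of the rank,
      so it is applied to each coefficient separately.\<close>
    proof (rule poly_eqI)
      fix c
      show "coeff (\<Sum>ys\<in>lists_over (ker_vecs xs) m. F (?n + m) (col_rank (xs @ ys))) c =
         coeff (\<Sum>i\<le>m. Polynomial.smult (q ^ (l * m) * rank_count q M m i) (F (?n + m) (l + i))) c"
        using sum_col_rank_append[OF nil_cols_colspan[OF xs] len, of "\<lambda>k. coeff (F (?n + m) k) c" m]
        by (simp add: coeff_sum q_def l_def)
    qed
    also have "\<dots> = (\<Sum>i\<le>m. Polynomial.smult (p ^ (l * (?n - l))) (monom 1 l *
        (Polynomial.smult (lin_coeff p M m i) (monom 1 i * rogers_szego p (M + m - 2 * i)))))"
    proof (rule sum.cong[OF refl])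
      fix i assume "i \<in> {..m}"
      hence im: "i \<le> m" by simp
      show "Polynomial.smult (q ^ (l * m) * rank_count q M m i) (F (?n + m) (l + i)) =
        Polynomial.smult (p ^ (l * (?n - l))) (monom 1 l *
        (Polynomial.smult (lin_coeff p M m i) (monom 1 i * rogers_szego p (M + m - 2 * i))))"
      proof (cases "i \<le> M")
        case True
        obtain a b where ab: "M = i + a" "m = i + b" using True im by (metis le_add_diff_inverse)
        \<comment> \<open>The three summands are the power of q from the lifts, the one from the
          rank count, and the weight exponent of \<open>xs\<close>. The first two cancel, and the
          third survives.\<close>
        have e: "(l + i) * (?n + m - (l + i)) = l * m + i * (M + m - i) + l * (?n - l)"
          unfolding n ab by (simp add: algebra_simps)
        have r: "q ^ (l * m) * rank_count q M m i * p ^ ((l + i) * (?n + m - (l + i))) = lin_coeff p M m i * p ^ (l * (?n - l))"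
          unfolding rank_count_eq_lin_coeff[OF q1 True] e pq power_add using q1 by (simp add: power_divide)
        have nn: "?n + m - 2 * (l + i) = M + m - 2 * i" by (simp add: n)
        have mm: "monom 1 l * (monom 1 i * R) = monom 1 (l + i) * R" for R :: "real poly"
          by (simp add: mult_monom flip: mult.assoc)
        show ?thesis
          unfolding F_def mult_smult_right smult_smult mm nn r mult.commute[of "lin_coeff p M m i"] ..
      qed (simp add: rank_count_eq_0' lin_coeff_eq_0 p)
    qed
    also have "\<dots> = F ?n l * rogers_szego p m"
    proof -
      have "?n - 2 * l = M" by (simp add: n)
      thus ?thesis by (simp add: F_def mult.assoc rogers_szego_mult[OF p] sum_distrib_left smult_sum_right)
    qed
    finally show ?thesis by (simp add: l_def)
  qed
  have inj: "inj_on (\<lambda>(xs, ys). xs @ ys) (SIGMA xs:(nil_cols lam :: (nat \<Rightarrow> 'a) list set). lists_over (ker_vecs xs) m)"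
    by (auto simp: inj_on_def nil_cols_def)
  have "(\<Sum>zs\<in>(nil_cols (lam @ [m]) :: (nat \<Rightarrow> 'a) list set). F (?n + m) (col_rank zs)) =
     (\<Sum>xs\<in>(nil_cols lam :: (nat \<Rightarrow> 'a) list set). \<Sum>ys\<in>lists_over (ker_vecs xs) m. F (?n + m) (col_rank (xs @ ys)))"
    unfolding nil_cols_snoc sum.reindex[OF inj]
    by (subst sum.Sigma) (auto simp: finite_nil_cols finite_lists_over finite_ker_vecs case_prod_unfold)
  also have "\<dots> = (\<Sum>xs\<in>(nil_cols lam :: (nat \<Rightarrow> 'a) list set). F ?n (col_rank xs)) * rogers_szego p m"
    by (simp add: inner sum_distrib_right)
  also have "\<dots> = prod_list (map (rogers_szego p) (lam @ [m]))"
    using snoc by (simp add: F_def)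
  finally show ?case by (simp add: F_def)
qed

section \<open>Matrices and column lists\<close>

definition fun_of_vec :: "'a::zero vec \<Rightarrow> nat \<Rightarrow> 'a" where
  "fun_of_vec v = (\<lambda>i. if i < dim_vec v then v $ i else 0)"

lemma bij_betw_fun_of_vec: "bij_betw fun_of_vec (carrier_vec n) (supp_vecs n)"
  by (rule bij_betw_byWitness[where f' = "vec n"])
     (auto simp: fun_of_vec_def supp_vecs_def fun_eq_iff vec_eq_iff)

lemma card_carrier_vec: "card (carrier_vec n :: 'a::{zero, finite} vec set) = CARD('a) ^ n"
  using bij_betw_same_card[OF bij_betw_fun_of_vec[where n = n and 'a = 'a]] by (simp add: card_supp_vecs)

text \<open>The rank of X is the size of a maximal independent set of its columns. The matrix
  \<open>B\<close> formed by such a set has the same column space as X and acts injectively, so this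
  space has q^rank elements.\<close>

lemma card_image_mult_mat_vec:
  fixes X :: "'a::{field, finite} mat"
  assumes X: "X \<in> carrier_mat n n"
  shows "card ((*\<^sub>v) X ` carrier_vec n) = CARD('a) ^ vec_space.rank n X"
proof -
  interpret vec_space "TYPE('a)" n .
  let ?C = "set (cols X)"
  have C: "?C \<subseteq> carrier_vec n" using X cols_dim[of X] by simp
  have img: "(*\<^sub>v) Y ` carrier_vec m = span (set (cols Y))" if "Y \<in> carrier_mat n m" for Y :: "'a mat" and m
  proof -
    have "span (set (cols Y)) = {y \<in> carrier_vec n. \<exists>x\<in>carrier_vec m. Y *\<^sub>v x = y}"
      using col_space_eq[OF that] that by (simp add: col_space_def)
    thus ?thesis using that by auto
  qed
  have "lin_indpt {}" by (simp add: lin_dep_def)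
  then obtain S where S: "finite S" "maximal S (\<lambda>T. T \<subseteq> ?C \<and> lin_indpt T)"
    using maximal_exists_superset[of ?C "\<lambda>T. T \<subseteq> ?C \<and> lin_indpt T" "{}"] by auto
  hence SC: "S \<subseteq> ?C" and ind: "lin_indpt S" by (auto simp: maximal_def)
  have Sc: "S \<subseteq> carrier_vec n" using SC C by blast
  have "?C \<subseteq> span S"
  proof
    fix s assume s: "s \<in> ?C"
    show "s \<in> span S"
    proof (rule ccontr)
      assume ns: "s \<notin> span S"
      hence sS: "s \<notin> S" using in_own_span[of S] Sc by auto
      hence "lin_indpt (S \<union> {s})" using lin_dep_iff_in_span[of S s] Sc ind s C ns by auto
      hence "S \<union> {s} = S" using S(2) s SC unfolding maximal_def by blast
      thus False using sS by blast
    qed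
  qed
  hence sp: "span S = span ?C"
    using span_is_monotone[OF SC] span_is_subset[of ?C "span S"] span_is_submodule[of S] Sc C by auto
  obtain ss where ss: "set ss = S" "distinct ss" using finite_distinct_list[OF S(1)] by blast
  define B where "B = mat_of_cols n ss"
  have B: "B \<in> carrier_mat n (length ss)" and cB: "cols B = ss" using ss Sc by (auto simp: B_def)
  have inj: "inj_on ((*\<^sub>v) B) (carrier_vec (length ss))"
  proof (rule inj_onI)
    fix x y assume xy: "x \<in> carrier_vec (length ss)" "y \<in> carrier_vec (length ss)" "B *\<^sub>v x = B *\<^sub>v y"
    have "B *\<^sub>v (x - y) = 0\<^sub>v n"
      using mult_minus_distrib_mat_vec[OF B xy(1,2)] xy B by simp
    hence "x - y = 0\<^sub>v (length ss)"
      using lin_depI[OF B, of "x - y"] xy ss ind cB by auto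
    hence "x $ i - y $ i = 0" if "i < length ss" for i
      using that xy by (metis carrier_vecD index_minus_vec(1) index_zero_vec(1))
    thus "x = y" using xy by (intro eq_vecI) auto
  qed
  have "card ((*\<^sub>v) X ` carrier_vec n) = card ((*\<^sub>v) B ` carrier_vec (length ss))"
    using img[OF X] img[OF B] sp cB ss by simp
  also have "\<dots> = CARD('a) ^ length ss" using card_image[OF inj] by (simp add: card_carrier_vec)
  also have "length ss = rank X" using rank_card_indpt[OF X S(2)] ss distinct_card by metis
  finally show ?thesis .
qed

definition col_funs :: "'a::zero mat \<Rightarrow> (nat \<Rightarrow> 'a) list" where
  "col_funs X = map fun_of_vec (cols X)"

lemma length_col_funs [simp]: "length (col_funs X) = dim_col X"
  by (simp add: col_funs_def)

lemma nth_col_funs: "j < dim_col X \<Longrightarrow> col_funs X ! j = fun_of_vec (col X j)"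
  by (simp add: col_funs_def)

lemma comb_col_funs:
  assumes "X \<in> carrier_mat n m" "v \<in> carrier_vec m"
  shows "comb (col_funs X) (fun_of_vec v) = fun_of_vec (X *\<^sub>v v)"
proof
  fix i
  show "comb (col_funs X) (fun_of_vec v) i = fun_of_vec (X *\<^sub>v v) i"
  proof (cases "i < n")
    case True
    thus ?thesis using assms
      by (auto simp: comb_def nth_col_funs fun_of_vec_def scalar_prod_def atLeast0LessThan mult.commute
          intro!: sum.cong)
  next
    case False
    thus ?thesis using assms by (auto simp: comb_def nth_col_funs fun_of_vec_def)
  qed
qed

lemma col_rank_col_funs:
  fixes X :: "'a::{field, finite} mat"
  assumes X: "X \<in> carrier_mat n n"
  shows "col_rank (col_funs X) = vec_space.rank n X"
proof (rule col_rank_eqI)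
  have "colspan (col_funs X) = comb (col_funs X) ` (fun_of_vec ` carrier_vec n)"
    using X bij_betw_fun_of_vec[where n = n and 'a = 'a] by (simp add: colspan_eq_image bij_betw_def)
  also have "\<dots> = fun_of_vec ` (*\<^sub>v) X ` carrier_vec n"
    unfolding image_image using comb_col_funs[OF X] by (intro image_cong) auto
  finally have "card (colspan (col_funs X)) = card (fun_of_vec ` (*\<^sub>v) X ` carrier_vec n)" by simp
  also have "\<dots> = card ((*\<^sub>v) X ` carrier_vec n)"
    using bij_betw_fun_of_vec[of n, where 'a = 'a] X
    by (intro card_image) (auto simp: bij_betw_def intro: inj_on_subset)
  finally show "card (colspan (col_funs X)) = CARD('a) ^ vec_space.rank n X"
    by (simp add: card_image_mult_mat_vec[OF X])
qed

lemma col_funs_in_nil_cols_iff: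
  fixes X :: "'a::field mat"
  assumes X: "X \<in> carrier_mat n n" and n: "n = sum_list lam"
  shows "col_funs X \<in> nil_cols lam \<longleftrightarrow> X \<in> nilradical lam \<and> X * X = 0\<^sub>m n n"
proof -
  have e: "(col_funs X ! j) i = (if i < n then X $$ (i, j) else 0)" if "j < n" for i j
    using that X by (simp add: nth_col_funs fun_of_vec_def)
  have "comb (col_funs X) (col_funs X ! j) = (\<lambda>_. 0) \<longleftrightarrow> col (X * X) j = 0\<^sub>v n" if "j < n" for j
  proof -
    have "comb (col_funs X) (col_funs X ! j) = fun_of_vec (X *\<^sub>v col X j)"
      using comb_col_funs[OF X, of "col X j"] that X by (simp add: nth_col_funs)
    also have "X *\<^sub>v col X j = col (X * X) j" using col_mult2[OF X X that] by simp
    finally have "comb (col_funs X) (col_funs X ! j) = fun_of_vec (col (X * X) j)" .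
    thus ?thesis using X that by (auto simp: fun_of_vec_def fun_eq_iff vec_eq_iff split: if_splits)
  qed
  moreover have "X * X = 0\<^sub>m n n \<longleftrightarrow> (\<forall>j<n. col (X * X) j = 0\<^sub>v n)"
  proof
    assume *: "\<forall>j<n. col (X * X) j = 0\<^sub>v n"
    show "X * X = 0\<^sub>m n n"
    proof (rule eq_matI)
      fix i j assume ij: "i < dim_row (0\<^sub>m n n)" "j < dim_col (0\<^sub>m n n)"
      hence "(X * X) $$ (i, j) = col (X * X) j $ i" using X by simp
      thus "(X * X) $$ (i, j) = 0\<^sub>m n n $$ (i, j)" using * ij by simp
    qed (use X in auto)
  qed auto
  ultimately show ?thesis
    using X unfolding nil_cols_def nilradical_def n[symmetric] by (auto simp: e)
qed

lemma a_count_eq_card_nil_cols: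
  assumes n: "n = sum_list lam"
  shows "a_count TYPE('a::{field, finite}) n k lam = card {xs \<in> (nil_cols lam :: (nat \<Rightarrow> 'a) list set). col_rank xs = k}"
proof -
  let ?A = "{X \<in> nilradical lam :: 'a mat set. X * X = 0\<^sub>m n n \<and> vec_space.rank n X = k}"
  let ?B = "{xs \<in> (nil_cols lam :: (nat \<Rightarrow> 'a) list set). col_rank xs = k}"
  let ?g = "\<lambda>xs. mat n n (\<lambda>(i, j). (xs ! j) i)"
  have iff: "X \<in> ?A \<longleftrightarrow> col_funs X \<in> ?B" if "X \<in> carrier_mat n n" for X
    using col_funs_in_nil_cols_iff[OF that n] col_rank_col_funs[OF that] by auto
  have A: "X \<in> carrier_mat n n" if "X \<in> ?A" for X using that n by (auto simp: nilradical_def)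
  have gf: "?g (col_funs X) = X" if "X \<in> carrier_mat n n" for X :: "'a mat"
    using that by (intro eq_matI) (auto simp: nth_col_funs fun_of_vec_def)
  have fg: "col_funs (?g xs) = xs" if "xs \<in> ?B" for xs
  proof (rule nth_equalityI)
    have len: "length xs = n" and supp: "set xs \<subseteq> supp_vecs n"
      using that n nil_cols_subset_supp[of xs lam] by (auto simp: nil_cols_def)
    show "length (col_funs (?g xs)) = length xs" using len by simp
    fix j assume "j < length (col_funs (?g xs))"
    hence j: "j < n" by simp
    hence "xs ! j \<in> supp_vecs n" using supp len by auto
    thus "col_funs (?g xs) ! j = xs ! j" using j
      by (auto simp: nth_col_funs fun_of_vec_def supp_vecs_def fun_eq_iff)
  qed
  have "bij_betw col_funs ?A ?B"
  proof (rule bij_betw_byWitness[where f' = ?g])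
    show "\<forall>X\<in>?A. ?g (col_funs X) = X" using A gf by blast
    show "\<forall>xs\<in>?B. col_funs (?g xs) = xs" using fg by blast
    show "col_funs ` ?A \<subseteq> ?B" using iff A by blast
    show "?g ` ?B \<subseteq> ?A"
    proof (rule image_subsetI)
      fix xs assume "xs \<in> ?B"
      thus "?g xs \<in> ?A" using iff[of "?g xs"] fg[of xs] by simp
    qed
  qed
  thus ?thesis unfolding a_count_def by (rule bij_betw_same_card)
qed

section \<open>Structure constants at t = 1\<close>

text \<open>The number of these pairs is the coefficient of the monomial with exponent vector
  \<open>ga\<close> in the product of the monomial symmetric functions of \<open>nu\<close> and
  \<open>rho\<close>, in \<open>length ga\<close> variables.\<close>

definition split_pairs :: "nat list \<Rightarrow> nat list \<Rightarrow> nat list \<Rightarrow> (nat list \<times> nat list) set" where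
  "split_pairs nu rho ga = {(al, be). al \<in> rearrangements (length ga) nu \<and>
     be \<in> rearrangements (length ga) rho \<and> map2 (+) al be = ga}"

definition parts_of :: "nat list \<Rightarrow> nat list" where
  "parts_of al = rev (sort (filter (\<lambda>a. a \<noteq> 0) al))"

lemma finite_rearrangements: "finite (rearrangements m lam)"
proof (rule finite_subset)
  show "rearrangements m lam \<subseteq> {al. set al \<subseteq> insert 0 (set lam) \<and> length al = m}"
  proof (clarify, intro conjI subsetI)
    fix al a assume al: "al \<in> rearrangements m lam"
    thus "length al = m" by (simp add: rearrangements_def)
    assume "a \<in> set al"
    hence *: "a \<noteq> 0 \<Longrightarrow> a \<in># filter_mset (\<lambda>p. p \<noteq> 0) (mset al)" by simp
    have "filter_mset (\<lambda>p. p \<noteq> 0) (mset al) = mset lam"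
      using al unfolding rearrangements_def by blast
    hence "a \<noteq> 0 \<Longrightarrow> a \<in> set lam" using * by (metis set_mset_mset)
    thus "a \<in> insert 0 (set lam)" by blast
  qed
qed (simp add: finite_lists_length_eq)

lemma finite_split_pairs: "finite (split_pairs nu rho ga)"
  by (rule finite_subset[OF _ finite_cartesian_product[OF
        finite_rearrangements[of "length ga" nu] finite_rearrangements[of "length ga" rho]]])
     (auto simp: split_pairs_def)

text \<open>Applying one permutation to both members of a pair is injective; using the inequality in
  both directions gives the symmetry of the coefficient in the variables.\<close>

lemma card_split_pairs_perm_le:
  assumes "mset ga = mset ga'"
  shows "card (split_pairs nu rho ga) \<le> card (split_pairs nu rho ga')"
proof -
  obtain f where f: "f permutes {..<length ga}" "permute_list f ga = ga'"
    using mset_eq_permutation[OF assms[symmetric]] by blast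
  have len: "length ga' = length ga" using assms by (metis size_mset)
  have inv: "permute_list (inv_into UNIV f) (permute_list f xs) = xs" if "length xs = length ga" for xs :: "nat list"
    using permute_list_compose[of "inv_into UNIV f" xs f] f permutes_inv[OF f(1)] that permutes_inv_o(1)[OF f(1)] by simp
  show ?thesis
  proof (rule card_inj_on_le)
    show "inj_on (\<lambda>(al, be). (permute_list f al, permute_list f be)) (split_pairs nu rho ga)"
    proof (rule inj_onI, clarify)
      fix a b c d assume "(a, b) \<in> split_pairs nu rho ga" "(c, d) \<in> split_pairs nu rho ga"
      hence "length a = length ga" "length b = length ga" "length c = length ga" "length d = length ga"
        by (auto simp: split_pairs_def rearrangements_def)
      moreover assume "permute_list f a = permute_list f c" "permute_list f b = permute_list f d"
      ultimately show "a = c \<and> b = d" using inv by metis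
    qed
    show "(\<lambda>(al, be). (permute_list f al, permute_list f be)) ` split_pairs nu rho ga \<subseteq> split_pairs nu rho ga'"
    proof clarify
      fix a b assume ab: "(a, b) \<in> split_pairs nu rho ga"
      hence l: "length a = length ga" "length b = length ga" and ga: "map2 (+) a b = ga"
        by (auto simp: split_pairs_def rearrangements_def)
      have "map2 (+) (permute_list f a) (permute_list f b) = permute_list f (map2 (+) a b)"
        using f l by (simp add: permute_list_map permute_list_zip[of f "{..<length a}" a b])
      thus "(permute_list f a, permute_list f b) \<in> split_pairs nu rho ga'"
        using ab f l len by (simp add: split_pairs_def rearrangements_def ga)
    qed
  qed (rule finite_split_pairs)
qed

lemma card_split_pairs_perm:
  "mset ga = mset ga' \<Longrightarrow> card (split_pairs nu rho ga) = card (split_pairs nu rho ga')"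
  by (intro antisym card_split_pairs_perm_le) auto

text \<open>Natural numbers with sum 0 are both 0, so the coefficient does not depend on the number
  of variables.\<close>

lemma card_split_pairs_pad:
  "card (split_pairs nu rho (ga @ replicate z 0)) = card (split_pairs nu rho ga)"
proof -
  let ?h = "\<lambda>(al, be). (al @ replicate z (0::nat), be @ replicate z (0::nat))"
  have "?h ` split_pairs nu rho ga = split_pairs nu rho (ga @ replicate z 0)"
  proof (intro equalityI subsetI)
    fix x assume "x \<in> ?h ` split_pairs nu rho ga"
    then obtain a b where x: "x = (a @ replicate z 0, b @ replicate z 0)" and ab: "(a, b) \<in> split_pairs nu rho ga"
      by auto
    hence "length a = length ga" "length b = length ga" "map2 (+) a b = ga"
      by (simp_all add: split_pairs_def rearrangements_def)
    thus "x \<in> split_pairs nu rho (ga @ replicate z 0)"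
      using ab by (simp add: x split_pairs_def rearrangements_def)
  next
    fix x assume x: "x \<in> split_pairs nu rho (ga @ replicate z 0)"
    obtain a b where ab: "x = (a, b)" by (cases x)
    have l: "length a = length ga + z" "length b = length ga + z" and e: "map2 (+) a b = ga @ replicate z 0"
      using x by (auto simp: split_pairs_def rearrangements_def ab)
    have "a ! i + b ! i = 0" if "length ga \<le> i" "i < length ga + z" for i
      using arg_cong[OF e, of "\<lambda>xs. xs ! i"] that l by (simp add: nth_append)
    hence "drop (length ga) a = replicate z 0" "drop (length ga) b = replicate z 0"
      using l by (auto intro!: nth_equalityI)
    hence a: "a = take (length ga) a @ replicate z 0" and b: "b = take (length ga) b @ replicate z 0"
      by (metis append_take_drop_id)+
    have "map2 (+) (take (length ga) a) (take (length ga) b) = ga"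
      using arg_cong[OF e, of "take (length ga)"] by (simp add: take_map take_zip)
    moreover have "filter_mset (\<lambda>p. p \<noteq> 0) (mset (take (length ga) a)) = filter_mset (\<lambda>p. p \<noteq> 0) (mset a)"
        "filter_mset (\<lambda>p. p \<noteq> 0) (mset (take (length ga) b)) = filter_mset (\<lambda>p. p \<noteq> 0) (mset b)"
      by (subst (2) a, simp) (subst (2) b, simp)
    ultimately have "(take (length ga) a, take (length ga) b) \<in> split_pairs nu rho ga"
      using x l by (simp add: split_pairs_def rearrangements_def ab)
    moreover have "x = ?h (take (length ga) a, take (length ga) b)"
      by (simp only: ab prod.case a[symmetric] b[symmetric])
    ultimately show "x \<in> ?h ` split_pairs nu rho ga" by (rule rev_image_eqI)
  qed
  moreover have "inj_on ?h (split_pairs nu rho ga)" by (auto simp: inj_on_def)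
  ultimately show ?thesis by (metis card_image)
qed

lemma mset_rearrangement:
  assumes "ga \<in> rearrangements m mu"
  shows "mset ga = mset (mu @ replicate (m - length mu) 0)"
proof -
  have "mset ga = filter_mset (\<lambda>p. p \<noteq> 0) (mset ga) + filter_mset (\<lambda>p. p = 0) (mset ga)"
    using multiset_partition[of "mset ga" "\<lambda>p. p \<noteq> 0"] by simp
  hence e: "mset ga = mset mu + replicate_mset (count (mset ga) 0) 0"
    using assms by (simp add: rearrangements_def filter_eq_replicate_mset)
  have "m = length mu + count (mset ga) 0"
    using arg_cong[OF e, of size] assms by (simp add: rearrangements_def)
  thus ?thesis using e by simp
qed

lemma card_split_pairs_rearrangement:
  assumes "ga \<in> rearrangements m mu"
  shows "card (split_pairs nu rho ga) = card (split_pairs nu rho mu)"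
  using card_split_pairs_perm[OF mset_rearrangement[OF assms]] by (simp add: card_split_pairs_pad)

lemma partition_mset_eq:
  assumes "mu \<in> partitions a" "mu' \<in> partitions b" "mset mu = mset mu'"
  shows "mu = mu'"
proof -
  have "sorted (rev mu)" "sorted (rev mu')" using assms by (auto simp: partitions_def sorted_wrt_rev)
  hence "sort mu = rev mu" "sort mu = rev mu'" using assms by (auto intro!: properties_for_sort)
  thus ?thesis by simp
qed

lemma parts_of_partition: "parts_of al \<in> partitions (sum_list al)"
proof -
  have "sum_list (parts_of al) = sum_list (filter (\<lambda>a. a \<noteq> 0) al)"
    unfolding parts_of_def by (simp add: sum_list_rev flip: sum_mset_sum_list)
  also have "\<dots> = sum_list al" by (induction al) auto
  finally show ?thesis by (auto simp: partitions_def parts_of_def sorted_wrt_rev)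
qed

lemma mset_parts_of: "mset (parts_of al) = filter_mset (\<lambda>a. a \<noteq> 0) (mset al)"
  by (simp add: parts_of_def mset_filter)

lemma rearrangements_partition_iff:
  assumes "nu \<in> partitions k"
  shows "al \<in> rearrangements m nu \<longleftrightarrow> length al = m \<and> parts_of al = nu"
  using partition_mset_eq[OF parts_of_partition assms]
  unfolding rearrangements_def mem_Collect_eq mset_parts_of[symmetric] by blast

lemma finite_partitions: "finite (partitions n)"
proof (rule finite_subset)
  show "partitions n \<subseteq> {xs. set xs \<subseteq> {..n} \<and> length xs \<le> n}"
  proof
    fix xs assume "xs \<in> partitions n"
    hence xs: "0 \<notin> set xs" "sum_list xs = n" by (auto simp: partitions_def)
    have "length xs \<le> sum_list xs" using xs(1) by (induction xs) (auto simp: Suc_le_eq)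
    thus "xs \<in> {xs. set xs \<subseteq> {..n} \<and> length xs \<le> n}" using xs member_le_sum_list[of _ xs] by auto
  qed
qed (simp add: finite_lists_length_le)

lemma hall_littlewood_P_1:
  assumes "inj_on x {..<m}"
  shows "hall_littlewood_P m x 1 lam = (\<Sum>al\<in>rearrangements m lam. \<Prod>i<m. x i ^ (al ! i))"
proof -
  have "(\<Prod>(i, j)\<in>{(i, j). i < m \<and> j < m \<and> al ! j < al ! i}. (x i - 1 * x j) / (x i - x j)) = 1" for al :: "nat list"
  proof (intro prod.neutral ballI, clarify)
    fix i j assume "i < m" "j < m" "al ! j < al ! i"
    hence "x i \<noteq> x j" using assms by (auto simp: inj_on_def)
    thus "(x i - 1 * x j) / (x i - x j) = 1" by simp
  qed
  thus ?thesis by (simp add: hall_littlewood_P_def)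
qed

lemma sum_list_map2_plus:
  "length al = length be \<Longrightarrow> sum_list (map2 (+) al be) = sum_list al + (sum_list be :: nat)"
  by (induction al be rule: list_induct2) auto

section \<open>Existence and uniqueness of the expansion at t = 1\<close>

definition monomial_coeff :: "nat list \<Rightarrow> nat list \<Rightarrow> nat list \<Rightarrow> real" where
  "monomial_coeff nu rho mu =
     (if mu \<in> (\<Union>n. partitions n) then real (card (split_pairs nu rho mu)) else 0)"

text \<open>The terms of the product are grouped first by their exponent vector and then by the
  partition underlying it. The number of splittings is constant on each class, so every class sums
  to a multiple of one monomial symmetric function.\<close>

lemma monomial_expansion:
  assumes nu: "nu \<in> partitions a" and rho: "rho \<in> partitions b"
  shows "is_hl_expansion nu rho 1 (monomial_coeff nu rho)"
proof -
  let ?c = "monomial_coeff nu rho"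
  let ?S = "{mu. ?c mu \<noteq> 0}"
  have sum_nz: "sum_list al = sum_list la" if "al \<in> rearrangements m la" for al la m
    using arg_cong[OF mset_rearrangement[OF that], of sum_mset] by (simp add: sum_mset_sum_list sum_list_replicate)
  have "?S \<subseteq> partitions (a + b)"
  proof
    fix mu assume "mu \<in> ?S"
    hence mu: "mu \<in> (\<Union>n. partitions n)" "split_pairs nu rho mu \<noteq> {}"
      by (auto simp: monomial_coeff_def split: if_splits)
    then obtain al be where "(al, be) \<in> split_pairs nu rho mu" by auto
    hence ab: "al \<in> rearrangements (length mu) nu" "be \<in> rearrangements (length mu) rho" "map2 (+) al be = mu"
      by (auto simp: split_pairs_def)
    hence "sum_list mu = sum_list al + sum_list be"
      using sum_list_map2_plus[of al be] by (auto simp: rearrangements_def)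
    also have "\<dots> = a + b" using sum_nz ab nu rho by (auto simp: partitions_def)
    finally show "mu \<in> partitions (a + b)" using mu by (auto simp: partitions_def)
  qed
  hence fin: "finite ?S" by (rule finite_subset) (rule finite_partitions)
  have "hall_littlewood_P m x 1 nu * hall_littlewood_P m x 1 rho = (\<Sum>mu\<in>?S. ?c mu * hall_littlewood_P m x 1 mu)"
    if x: "inj_on x {..<m}" for m :: nat and x :: "nat \<Rightarrow> real"
  proof -
    let ?R = "rearrangements m"
    define X where "X ga = (\<Prod>i<m. x i ^ (ga ! i))" for ga :: "nat list"
    let ?A = "?R nu \<times> ?R rho"
    let ?g = "\<lambda>(al, be). map2 (+) al be :: nat list"
    let ?G = "?g ` ?A"
    have lenR: "length al = m" if "al \<in> ?R la" for al la using that by (simp add: rearrangements_def)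
    have "hall_littlewood_P m x 1 nu * hall_littlewood_P m x 1 rho = (\<Sum>(al, be)\<in>?A. X al * X be)"
      unfolding hall_littlewood_P_1[OF x] X_def[symmetric] sum_product sum.cartesian_product ..
    also have "\<dots> = (\<Sum>z\<in>?A. X (?g z))"
    proof (intro sum.cong refl, clarify)
      fix al be assume "al \<in> ?R nu" "be \<in> ?R rho"
      hence "length al = m" "length be = m" by (auto simp: lenR)
      thus "X al * X be = X (map2 (+) al be)"
        unfolding X_def prod.distrib[symmetric] by (intro prod.cong refl) (simp add: power_add)
    qed
    also have "\<dots> = (\<Sum>ga\<in>?G. \<Sum>z\<in>{z \<in> ?A. ?g z = ga}. X (?g z))"
      by (rule sum.image_gen) (simp add: finite_rearrangements)
    also have "\<dots> = (\<Sum>ga\<in>?G. real (card (split_pairs nu rho ga)) * X ga)"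
    proof (rule sum.cong[OF refl])
      fix ga assume "ga \<in> ?G"
      hence "length ga = m" by (auto simp: lenR)
      hence "{z \<in> ?A. ?g z = ga} = split_pairs nu rho ga" by (auto simp: split_pairs_def)
      moreover have "(\<Sum>z\<in>{z \<in> ?A. ?g z = ga}. X (?g z)) = (\<Sum>z\<in>{z \<in> ?A. ?g z = ga}. X ga)"
        by (rule sum.cong) auto
      ultimately show "(\<Sum>z\<in>{z \<in> ?A. ?g z = ga}. X (?g z)) = real (card (split_pairs nu rho ga)) * X ga" by simp
    qed
    also have "?G = (\<Union>mu\<in>?S. ?R mu)"
    proof (intro equalityI subsetI)
      fix ga assume ga: "ga \<in> ?G"
      then obtain al be where ab: "al \<in> ?R nu" "be \<in> ?R rho" "ga = map2 (+) al be" by auto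
      hence len: "length ga = m" by (simp add: lenR)
      have "(al, be) \<in> split_pairs nu rho ga" using ab len by (simp add: split_pairs_def)
      hence "card (split_pairs nu rho ga) \<noteq> 0" using finite_split_pairs by auto
      moreover have R: "ga \<in> ?R (parts_of ga)" using len by (simp add: rearrangements_def mset_parts_of)
      ultimately have "card (split_pairs nu rho (parts_of ga)) \<noteq> 0" by (simp add: card_split_pairs_rearrangement)
      hence "parts_of ga \<in> ?S" using parts_of_partition by (auto simp: monomial_coeff_def)
      thus "ga \<in> (\<Union>mu\<in>?S. ?R mu)" using R by blast
    next
      fix ga assume "ga \<in> (\<Union>mu\<in>?S. ?R mu)"
      then obtain mu where mu: "mu \<in> ?S" "ga \<in> ?R mu" by blast
      hence "card (split_pairs nu rho ga) \<noteq> 0"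
        by (simp add: card_split_pairs_rearrangement monomial_coeff_def split: if_splits)
      then obtain z where "z \<in> split_pairs nu rho ga" by (metis card.empty ex_in_conv)
      thus "ga \<in> ?G" using lenR[OF mu(2)] by (auto simp: split_pairs_def intro!: image_eqI[of _ _ z])
    qed
    also have "(\<Sum>ga\<in>(\<Union>mu\<in>?S. ?R mu). real (card (split_pairs nu rho ga)) * X ga)
        = (\<Sum>mu\<in>?S. \<Sum>ga\<in>?R mu. real (card (split_pairs nu rho ga)) * X ga)"
    proof (rule sum.UNION_disjoint[OF fin])
      show "\<forall>i\<in>?S. \<forall>j\<in>?S. i \<noteq> j \<longrightarrow> ?R i \<inter> ?R j = {}"
      proof (intro ballI impI, rule ccontr)
        fix i j assume ij: "i \<in> ?S" "j \<in> ?S" "i \<noteq> j" "?R i \<inter> ?R j \<noteq> {}"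
        hence "mset i = mset j" by (auto simp: rearrangements_def)
        thus False using ij partition_mset_eq by (auto simp: monomial_coeff_def split: if_splits)
      qed
    qed (auto simp: finite_rearrangements)
    also have "\<dots> = (\<Sum>mu\<in>?S. ?c mu * hall_littlewood_P m x 1 mu)"
      unfolding hall_littlewood_P_1[OF x] X_def[symmetric] sum_distrib_left
      by (intro sum.cong refl) (auto simp: card_split_pairs_rearrangement monomial_coeff_def split: if_splits)
    finally show ?thesis .
  qed
  moreover have "\<forall>mu. ?c mu \<noteq> 0 \<longrightarrow> mu \<in> (\<Union>n. partitions n)" by (auto simp: monomial_coeff_def)
  ultimately show ?thesis using fin by (auto simp: is_hl_expansion_def)
qed

text \<open>Uniqueness of digits in base B: reduction modulo B recovers the leading entry of the
  list.\<close>

lemma horner_sum_inj: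
  assumes "length xs = length ys" "set xs \<subseteq> {..<B}" "set ys \<subseteq> {..<B}"
    and "horner_sum (\<lambda>a. a) B xs = horner_sum (\<lambda>a. a) (B::nat) ys"
  shows "xs = ys"
  using assms
proof (induction xs ys rule: list_induct2)
  case (Cons x xs y ys)
  have "(x + B * horner_sum (\<lambda>a. a) B xs) mod B = (y + B * horner_sum (\<lambda>a. a) B ys) mod B"
    using Cons.prems(3) by simp
  hence xy: "x = y" using Cons.prems by simp
  hence "horner_sum (\<lambda>a. a) B xs = horner_sum (\<lambda>a. a) B ys" using Cons.prems by auto
  thus ?case using xy Cons by simp
qed simp

text \<open>Substituting \<open>x\<^sub>i = t ^ B ^ i\<close> turns distinct monomials with exponents below \<open>B\<close>
  into distinct powers of \<open>t\<close>.\<close>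
lemma hl_expansion_unique:
  assumes "is_hl_expansion nu rho 1 c" "is_hl_expansion nu rho 1 c'"
  shows "c = c'"
proof (rule ext, rule ccontr)
  fix mu0 assume ne: "c mu0 \<noteq> c' mu0"
  define S where "S = {mu. c mu \<noteq> 0} \<union> {mu. c' mu \<noteq> 0}"
  define d where "d mu = c mu - c' mu" for mu
  \<comment> \<open>With as many variables as \<open>mu0\<close> has parts, \<open>mu0\<close> is
    its own rearrangement, so its monomial really occurs.\<close>
  define m where "m = length mu0"
  let ?R = "rearrangements m"
  have fin: "finite S" and part: "\<And>mu. mu \<in> S \<Longrightarrow> mu \<in> (\<Union>n. partitions n)"
    using assms by (auto simp: S_def is_hl_expansion_def)
  have mu0: "mu0 \<in> S" using ne by (auto simp: S_def)
  \<comment> \<open>One \<open>Suc\<close> makes all exponents smaller than B; the other ensures B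
    >= 2, so that the powers B^i, and with them the coordinates, are pairwise distinct.\<close>
  define B where "B = Suc (Suc (\<Sum>mu\<in>S. sum_list mu))"
  have small: "set ga \<subseteq> {..<B}" if "mu \<in> S" "ga \<in> ?R mu" for mu ga
  proof
    fix a assume "a \<in> set ga"
    hence "a \<in># mset (mu @ replicate (m - length mu) 0)"
      using mset_rearrangement[OF that(2)] by (metis set_mset_mset)
    hence "a \<le> sum_list mu" using member_le_sum_list by (auto split: if_splits)
    also have "\<dots> \<le> (\<Sum>mu\<in>S. sum_list mu)" using fin that by (intro member_le_sum) auto
    finally show "a \<in> {..<B}" by (simp add: B_def)
  qed
  \<comment> \<open>The difference of the two expansions after the substitution. It vanishes for all
    t > 1 and is therefore the zero polynomial, while its coefficient at the code of
    \<open>mu0\<close> is \<open>d mu0\<close>.\<close>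
  define P where "P = (\<Sum>mu\<in>S. \<Sum>ga\<in>?R mu. monom (d mu) (horner_sum (\<lambda>a. a) B ga))"
  have "poly P t = 0" if t: "t > 1" for t :: real
  proof -
    define x where "x i = t ^ (B ^ i)" for i
    have x: "inj_on x {..<m}"
      using t by (auto simp: inj_on_def x_def B_def)
    have X: "(\<Prod>i<m. x i ^ (ga ! i)) = t ^ horner_sum (\<lambda>a. a) B ga" if "length ga = m" for ga
      using that by (simp add: x_def horner_sum_eq_sum power_sum mult.commute atLeast0LessThan flip: power_mult)
    have ext: "(\<Sum>mu | e mu \<noteq> 0. e mu * hall_littlewood_P m x 1 mu) = (\<Sum>mu\<in>S. e mu * hall_littlewood_P m x 1 mu)"
      if "{mu. e mu \<noteq> 0} \<subseteq> S" for e
      using that fin by (intro sum.mono_neutral_left) auto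
    have "(\<Sum>mu\<in>S. c mu * hall_littlewood_P m x 1 mu) = (\<Sum>mu\<in>S. c' mu * hall_littlewood_P m x 1 mu)"
      using assms x ext[of c] ext[of c'] by (simp add: is_hl_expansion_def S_def)
    hence "(\<Sum>mu\<in>S. d mu * hall_littlewood_P m x 1 mu) = 0"
      by (simp add: d_def algebra_simps sum_subtractf)
    also have "(\<Sum>mu\<in>S. d mu * hall_littlewood_P m x 1 mu) = poly P t"
      unfolding P_def poly_sum poly_monom hall_littlewood_P_1[OF x] sum_distrib_left
      by (intro sum.cong refl arg_cong2[of _ _ _ _ "(*)"] X) (auto simp: rearrangements_def)
    finally show ?thesis .
  qed
  hence "{1<..} \<subseteq> {t. poly P t = 0}" by auto
  hence "infinite {t. poly P t = 0}" using infinite_Ioi infinite_super by blast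
  hence P0: "P = 0" using poly_roots_finite by blast
  have mu0R: "mu0 \<in> ?R mu \<longleftrightarrow> mu = mu0" if mu: "mu \<in> S" for mu
  proof -
    obtain k l where "mu \<in> partitions k" "mu0 \<in> partitions l" using part[OF mu] part[OF mu0] by blast
    moreover from this have "filter_mset (\<lambda>p. p \<noteq> 0) (mset mu0) = mset mu0"
      by (auto simp: partitions_def filter_mset_eq_conv intro!: gr0I)
    ultimately show ?thesis using partition_mset_eq by (auto simp: rearrangements_def m_def)
  qed
  have code: "horner_sum (\<lambda>a. a) B ga = horner_sum (\<lambda>a. a) B mu0 \<longleftrightarrow> ga = mu0"
    if "mu \<in> S" "ga \<in> ?R mu" for mu ga
    using horner_sum_inj[of ga mu0 B] small[OF that] small[OF mu0, of mu0] mu0R[OF mu0] that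
    by (auto simp: rearrangements_def m_def)
  have "coeff P (horner_sum (\<lambda>a. a) B mu0)
      = (\<Sum>mu\<in>S. \<Sum>ga\<in>?R mu. if ga = mu0 then d mu else 0)"
    unfolding P_def coeff_sum coeff_monom by (intro sum.cong refl) (simp add: code)
  also have "\<dots> = (\<Sum>mu\<in>S. if mu = mu0 then d mu else 0)"
    by (intro sum.cong refl) (auto simp: finite_rearrangements mu0R)
  also have "\<dots> = d mu0" using fin mu0 by simp
  finally show False using P0 ne by (simp add: d_def)
qed

lemma hl_coeff_1:
  assumes "nu \<in> partitions a" "rho \<in> partitions b" "lam \<in> partitions n"
  shows "hl_coeff lam nu rho 1 = real (card (split_pairs nu rho lam))"
proof -
  have "(THE c. is_hl_expansion nu rho 1 c) = monomial_coeff nu rho"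
    using monomial_expansion[OF assms(1,2)] hl_expansion_unique by (intro the_equality) auto
  thus ?thesis using assms by (auto simp: hl_coeff_def monomial_coeff_def)
qed

section \<open>Coefficients of products as sums over splittings of the parts\<close>

definition weak_splits :: "nat list \<Rightarrow> nat \<Rightarrow> (nat list \<times> nat list) set" where
  "weak_splits lam r = {(al, be). length al = length lam \<and> length be = length lam \<and>
     map2 (+) al be = lam \<and> sum_list be = r}"

lemma finite_weak_splits: "finite (weak_splits lam r)"
proof (rule finite_subset)
  let ?L = "{xs. set xs \<subseteq> {..sum_list lam} \<and> length xs = length lam}"
  show "weak_splits lam r \<subseteq> ?L \<times> ?L"
  proof clarify
    fix al be assume ab: "(al, be) \<in> weak_splits lam r"
    hence "sum_list al + sum_list be = sum_list lam" using sum_list_map2_plus[of al be] by (auto simp: weak_splits_def)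
    hence "set al \<subseteq> {..sum_list lam}" "set be \<subseteq> {..sum_list lam}"
      using member_le_sum_list[of _ al] member_le_sum_list[of _ be] by force+
    thus "al \<in> ?L \<and> be \<in> ?L" using ab by (simp add: weak_splits_def)
  qed
qed (intro finite_cartesian_product finite_lists_length_eq; simp)+

text \<open>Dropping zeros and sorting sends a splitting lam = al + be to a pair of partitions, and
  the fibre over (nu, rho) is \<open>split_pairs nu rho lam\<close>, whose size is the structure
  constant. Because of g(0) = 1 the weight is constant on each fibre.\<close>

lemma sum_hl_coeff:
  fixes g :: "nat \<Rightarrow> real"
  assumes g0: "g 0 = 1" and lam: "lam \<in> partitions (a + b)"
  shows "(\<Sum>nu\<in>partitions a. \<Sum>rho\<in>partitions b.
      prod_list (map g nu) * prod_list (map g rho) * hl_coeff lam nu rho 1) =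
    (\<Sum>(al, be)\<in>weak_splits lam b. prod_list (map g al) * prod_list (map g be))"
proof -
  let ?h = "\<lambda>(al, be). prod_list (map g al) * prod_list (map g be)"
  let ?p = "\<lambda>(al, be). (parts_of al, parts_of be)"
  have gp: "prod_list (map g (parts_of al)) = prod_list (map g al)" for al
  proof -
    have "prod_list (map g (parts_of al)) = prod_mset (image_mset g (mset (parts_of al)))"
      by (simp flip: prod_mset_prod_list)
    also have "\<dots> = prod_mset (image_mset g (mset (filter (\<lambda>a. a \<noteq> 0) al)))"
      by (simp add: mset_parts_of mset_filter)
    also have "\<dots> = prod_list (map g (filter (\<lambda>a. a \<noteq> 0) al))"
      by (simp flip: prod_mset_prod_list)
    also have "\<dots> = prod_list (map g al)" by (induction al) (auto simp: g0)
    finally show ?thesis .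
  qed
  have sums: "sum_list al = a" if "(al, be) \<in> weak_splits lam b" for al be
    using that sum_list_map2_plus[of al be] lam by (auto simp: weak_splits_def partitions_def)
  have img: "?p ` weak_splits lam b \<subseteq> partitions a \<times> partitions b"
  proof (rule image_subsetI)
    fix z assume z: "z \<in> weak_splits lam b"
    obtain al be where ab: "z = (al, be)" by (cases z)
    hence w: "(al, be) \<in> weak_splits lam b" using z by simp
    have "sum_list al = a" by (rule sums[OF w])
    moreover have "sum_list be = b" using w by (simp add: weak_splits_def)
    ultimately show "?p z \<in> partitions a \<times> partitions b"
      using parts_of_partition[of al] parts_of_partition[of be] by (simp add: ab)
  qed
  have fib: "{z \<in> weak_splits lam b. ?p z = (nu, rho)} = split_pairs nu rho lam"
    if "nu \<in> partitions a" "rho \<in> partitions b" for nu rho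
  proof -
    have "sum_list be = b" if "parts_of be = rho" for be
      using parts_of_partition[of be] that \<open>rho \<in> partitions b\<close> by (simp add: partitions_def)
    thus ?thesis using that by (auto simp: weak_splits_def split_pairs_def rearrangements_partition_iff)
  qed
  have "(\<Sum>z\<in>weak_splits lam b. ?h z) =
      (\<Sum>y\<in>partitions a \<times> partitions b. \<Sum>z\<in>{z \<in> weak_splits lam b. ?p z = y}. ?h z)"
    using sum.group[OF finite_weak_splits _ img, of ?h] by (simp add: finite_partitions)
  also have "\<dots> = (\<Sum>(nu, rho)\<in>partitions a \<times> partitions b.
      prod_list (map g nu) * prod_list (map g rho) * hl_coeff lam nu rho 1)"
  proof (intro sum.cong refl, clarify)
    fix nu rho assume nr: "nu \<in> partitions a" "rho \<in> partitions b"
    have "(\<Sum>z\<in>split_pairs nu rho lam. ?h z) = (\<Sum>z\<in>split_pairs nu rho lam. prod_list (map g nu) * prod_list (map g rho))"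
    proof (intro sum.cong refl, clarify)
      fix al be assume "(al, be) \<in> split_pairs nu rho lam"
      hence "parts_of al = nu" "parts_of be = rho"
        using nr by (auto simp: split_pairs_def rearrangements_partition_iff)
      thus "prod_list (map g al) * prod_list (map g be) = prod_list (map g nu) * prod_list (map g rho)"
        using gp by metis
    qed
    thus "(\<Sum>z\<in>{z \<in> weak_splits lam b. ?p z = (nu, rho)}. ?h z) =
        prod_list (map g nu) * prod_list (map g rho) * hl_coeff lam nu rho 1"
      using nr lam by (simp add: fib hl_coeff_1)
  qed
  finally show ?thesis by (simp add: sum.cartesian_product)
qed

text \<open>A splitting records the degree \<open>be ! i\<close> taken from the i-th factor and its
  complement \<open>al ! i\<close>.\<close>

lemma coeff_prod_list_weak_splits:
  fixes h :: "nat \<Rightarrow> nat \<Rightarrow> 'a::comm_semiring_1"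
  assumes "\<And>l i. coeff (f l) i = (if i \<le> l then h (l - i) i else 0)"
  shows "coeff (prod_list (map f lam)) r = (\<Sum>(al, be)\<in>weak_splits lam r. prod_list (map2 h al be))"
proof (induction lam arbitrary: r)
  case Nil
  have "weak_splits [] r = (if r = 0 then {([], [])} else {})" by (auto simp: weak_splits_def)
  thus ?case by simp
next
  case (Cons l lam)
  let ?A = "{i. i \<le> r \<and> i \<le> l}"
  let ?j = "\<lambda>(i, al, be). ((l - i) # al, i # be)"
  have im: "?j ` (SIGMA i:?A. weak_splits lam (r - i)) = weak_splits (l # lam) r"
  proof (intro equalityI subsetI)
    fix z assume zw: "z \<in> weak_splits (l # lam) r"
    obtain as bs where z': "z = (as, bs)" by (cases z)
    have "length as = Suc (length lam)" "length bs = Suc (length lam)"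
      using zw by (simp_all add: z' weak_splits_def)
    then obtain a al b be where ab: "as = a # al" "bs = b # be" by (metis length_Suc_conv)
    have z: "z = (a # al, b # be)" by (simp only: z' ab)
    have w: "(al, be) \<in> weak_splits lam (r - b)" "b \<le> r" "a + b = l"
    proof -
      have "length (a # al) = length (l # lam)" "length (b # be) = length (l # lam)"
        and m: "map2 (+) (a # al) (b # be) = l # lam" and s: "sum_list (b # be) = r"
        using zw by (simp_all only: z weak_splits_def mem_Collect_eq prod.case)
      moreover from m have "a + b = l" "map2 (+) al be = lam" by simp_all
      moreover from s have "sum_list be = r - b" "b \<le> r" by simp_all
      ultimately show "(al, be) \<in> weak_splits lam (r - b)" "b \<le> r" "a + b = l"
        by (simp_all add: weak_splits_def)
    qed
    show "z \<in> ?j ` (SIGMA i:?A. weak_splits lam (r - i))"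
    proof (rule rev_image_eqI)
      show "(b, al, be) \<in> (SIGMA i:?A. weak_splits lam (r - i))" using w by simp
      show "z = ?j (b, al, be)" using w z by simp
    qed
  next
    fix z assume "z \<in> ?j ` (SIGMA i:?A. weak_splits lam (r - i))"
    then obtain i al be where z: "z = ((l - i) # al, i # be)" and i: "i \<le> r" "i \<le> l"
      and w: "(al, be) \<in> weak_splits lam (r - i)" by auto
    have "length al = length lam" "length be = length lam" "map2 (+) al be = lam" "sum_list be = r - i"
      using w by (simp_all only: weak_splits_def mem_Collect_eq prod.case)
    thus "z \<in> weak_splits (l # lam) r" using i unfolding z weak_splits_def by simp
  qed
  have inj: "inj_on ?j (SIGMA i:?A. weak_splits lam (r - i))" by (auto simp: inj_on_def)
  have "coeff (prod_list (map f (l # lam))) r = (\<Sum>i\<le>r. coeff (f l) i * coeff (prod_list (map f lam)) (r - i))"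
    by (simp add: coeff_mult)
  also have "\<dots> = (\<Sum>i\<in>?A. h (l - i) i * coeff (prod_list (map f lam)) (r - i))"
    by (rule sum.mono_neutral_cong_right) (auto simp: assms)
  also have "\<dots> = (\<Sum>i\<in>?A. \<Sum>(al, be)\<in>weak_splits lam (r - i). h (l - i) i * prod_list (map2 h al be))"
    by (simp add: Cons.IH sum_distrib_left case_prod_unfold)
  also have "\<dots> = (\<Sum>(i, al, be)\<in>(SIGMA i:?A. weak_splits lam (r - i)). h (l - i) i * prod_list (map2 h al be))"
    by (subst sum.Sigma) (auto simp: finite_weak_splits)
  also have "\<dots> = (\<Sum>(al, be)\<in>weak_splits (l # lam) r. prod_list (map2 h al be))"
    unfolding im[symmetric] sum.reindex[OF inj] by (intro sum.cong refl) auto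
  finally show ?case .
qed

lemma sum_lessThan_choose_2: "(\<Sum>i<n. i) = n choose 2"
  by (induction n) (simp_all add: numeral_2_eq_2)

text \<open>Summed over the parts instead of the columns, n(lam') collects 0 + 1 + ... + (a - 1)
  from each part a.\<close>

lemma n_stat_conj_partition: "n_stat (conj_partition lam) = sum_list (map (\<lambda>a. a choose 2) lam)"
proof -
  \<comment> \<open>The bound \<open>M\<close> is separated from the list so that it stays fixed
    while the induction removes parts. List position i belongs to the threshold i + 1 in
    \<open>conj_partition\<close>.\<close>
  have aux: "(\<Sum>i<M. i * length (filter (\<lambda>a. Suc i \<le> a) la)) = sum_list (map (\<lambda>a. a choose 2) la)"
    if "\<forall>a\<in>set la. a \<le> M" for M and la :: "nat list"
    using that
  proof (induction la)
    case (Cons a la)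
    have "(\<Sum>i<M. i * length (filter (\<lambda>a. Suc i \<le> a) (a # la))) =
        (\<Sum>i<M. (if Suc i \<le> a then i else 0) + i * length (filter (\<lambda>a. Suc i \<le> a) la))"
      by (intro sum.cong) auto
    also have "\<dots> = (\<Sum>i<M. (if Suc i \<le> a then i else 0)) + sum_list (map (\<lambda>a. a choose 2) la)"
      using Cons by (simp add: sum.distrib)
    also have "(\<Sum>i<M. (if Suc i \<le> a then i else 0)) = (\<Sum>i<a. i)"
      using Cons.prems by (intro sum.mono_neutral_cong_right) auto
    finally show ?case by (simp add: sum_lessThan_choose_2)
  qed simp
  have "\<forall>a\<in>set lam. a \<le> foldr max lam 0" by (induction lam) auto
  note aux[OF this]
  moreover have "n_stat (conj_partition lam) = (\<Sum>i<foldr max lam 0. i * length (filter (\<lambda>a. Suc i \<le> a) lam))"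
    unfolding n_stat_def conj_partition_def by (intro sum.cong) (auto simp del: upt_Suc)
  ultimately show ?thesis by simp
qed

section \<open>The counting formula\<close>

lemma q_fact_Suc: "q_fact q (Suc m) = q_fact q m * q_int q (Suc m)"
  by (simp add: q_fact_def)

lemma q_fact_pos:
  assumes "1 < q"
  shows "0 < q_fact q m"
  unfolding q_fact_def q_int_def using assms by (intro prod_pos) (auto intro!: divide_pos_pos one_less_power)

lemma one_minus_inverse_power: "q \<noteq> 0 \<Longrightarrow> 1 - (1 / q) ^ m = (1 / q) ^ m * (q ^ m - 1 :: real)"
  by (simp add: algebra_simps flip: power_mult_distrib)

lemma power_int_diff_of_nat: "q \<noteq> 0 \<Longrightarrow> q powi (int a - int b) = q ^ a * (1 / q :: real) ^ b"
  by (simp add: power_int_diff power_one_over divide_inverse power_inverse)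

lemma qpoch_inverse:
  assumes "1 < q"
  shows "qpoch (1 / q) m = (1 / q) ^ (Suc m choose 2) * (q - 1) ^ m * q_fact q m"
proof (induction m)
  case 0
  show ?case by (simp add: q_fact_def binomial_eq_0)
next
  case (Suc m)
  have "Suc (Suc m) choose 2 = (Suc m choose 2) + Suc m" by (simp add: numeral_2_eq_2)
  moreover have "1 - (1 / q) ^ Suc m = (1 / q) ^ Suc m * ((q - 1) * q_int q (Suc m))"
    using assms one_minus_inverse_power[of q "Suc m"] by (simp add: q_int_def del: power_Suc)
  ultimately show ?case
    by (simp only: qpoch_Suc Suc q_fact_Suc power_add) (simp add: mult_ac)
qed

lemma choose_2_add: "(a + b) choose 2 = (a choose 2) + (b choose 2) + a * b"
  by (induction b) (simp_all add: numeral_2_eq_2)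

text \<open>The powers of q - 1 from \<open>qpoch_inverse\<close> cancel, and the exponents combine
  to C(a+b+1, 2) - C(a+1, 2) - C(b+1, 2) = a b.\<close>

lemma gauss_binom_inverse:
  assumes "1 < q"
  shows "gauss_binom (1 / q) (a + b) b = (1 / q) ^ (a * b) * q_fact q (a + b) / (q_fact q a * q_fact q b)"
proof -
  have "Suc (a + b) choose 2 = (Suc a choose 2) + (Suc b choose 2) + a * b"
    using choose_2_add[of a b] by (simp add: numeral_2_eq_2)
  moreover have "q_fact q a \<noteq> 0" "q_fact q b \<noteq> 0" using q_fact_pos[OF assms] by (simp_all add: less_imp_neq[symmetric])
  ultimately show ?thesis
    using assms by (simp add: gauss_binom_def qpoch_inverse power_add field_simps)
qed

text \<open>In passing from 1/q to q the binomial contributes q^(-e j) and the quotient contributes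
  q^(-j), which turns C(j, 2) into C(j+1, 2).\<close>

lemma inv_coeff_inverse:
  assumes q: "1 < q"
  shows "inv_coeff (1 / q) e j = (-1) ^ j * q powi (- int ((j + 1) choose 2) - int (e * j)) * q_binom q (e + j) j
      * (if e + j = 0 then 1 else (q ^ (e + 2 * j) - 1) / (q ^ (e + j) - 1))"
proof (cases "e + j = 0")
  case True
  thus ?thesis using inv_coeff_0[of "1 / q" 0] q by (simp add: q_binom_def q_fact_def binomial_eq_0)
next
  case False
  define p where "p = 1 / q"
  have p0: "p \<noteq> 0" "q \<noteq> 0" using q by (auto simp: p_def)
  have "(j + 1) choose 2 = (j choose 2) + j" by (simp add: numeral_2_eq_2)
  hence "- int ((j + 1) choose 2) - int (e * j) = int 0 - int ((j choose 2) + j + e * j)" by simp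
  hence powi: "q powi (- int ((j + 1) choose 2) - int (e * j)) = p ^ (j choose 2) * p ^ j * p ^ (e * j)"
    using power_int_diff_of_nat[OF p0(2), of 0 "(j choose 2) + j + e * j"]
    by (simp only: p_def power_add power_0 mult_1)
  have "p ^ (j choose 2) * (gauss_binom p (e + j) j * (1 - p ^ (e + 2 * j)) / (1 - p ^ (e + j)))
     = p ^ (j choose 2) * (p ^ (e * j) * q_binom q (e + j) j * (p ^ (e + 2 * j) * (q ^ (e + 2 * j) - 1)) / (p ^ (e + j) * (q ^ (e + j) - 1)))"
    using gauss_binom_inverse[OF q, of e j] p0 one_minus_inverse_power[OF p0(2)]
    by (simp add: p_def q_binom_def mult.commute)
  also have "\<dots> = p ^ (j choose 2) * (p ^ (e * j) * q_binom q (e + j) j *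
      (p ^ (e + j) * p ^ j * (q ^ (e + 2 * j) - 1)) / (p ^ (e + j) * (q ^ (e + j) - 1)))"
    by (simp add: power_add mult_2)
  also have "\<dots> = q powi (- int ((j + 1) choose 2) - int (e * j)) * q_binom q (e + j) j
      * ((q ^ (e + 2 * j) - 1) / (q ^ (e + j) - 1))"
    unfolding powi using p0 by simp
  finally have *: "p ^ (j choose 2) * (gauss_binom p (e + j) j * (1 - p ^ (e + 2 * j)) / (1 - p ^ (e + j))) =
      q powi (- int ((j + 1) choose 2) - int (e * j)) * q_binom q (e + j) j
      * ((q ^ (e + 2 * j) - 1) / (q ^ (e + j) - 1))" .
  have "0 < p" "p < 1" using q by (auto simp: p_def)
  hence "inv_coeff p e j = (-1) ^ j * (p ^ (j choose 2) *
      (gauss_binom p (e + j) j * (1 - p ^ (e + 2 * j)) / (1 - p ^ (e + j))))"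
    using False by (simp add: inv_coeff_def del: power_0)
  thus ?thesis unfolding * p_def[symmetric] using False by (simp only: if_False mult.assoc)
qed

text \<open>As a b = C(a+b, 2) - C(a, 2) - C(b, 2), each binomial in base 1/q is [a+b]_q! q^(-C(a+b,
  2)) times g(a) g(b) with g(a) = q^C(a, 2) / [a]_q!. The first factors depend on \<open>lam\<close>
  alone and are the origin of [lam]_q! and q^(-n(lam')) in the counting formula.\<close>

lemma coeff_prod_rogers_szego:
  assumes q: "1 < q" and lam: "lam \<in> partitions (a + b)"
  shows "coeff (prod_list (map (rogers_szego (1 / q)) lam)) b =
    q_fact_list q lam * (1 / q) ^ n_stat (conj_partition lam) *
    (\<Sum>nu\<in>partitions a. \<Sum>rho\<in>partitions b.
       q ^ (n_stat (conj_partition nu) + n_stat (conj_partition rho)) * hl_coeff lam nu rho 1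
         / (q_fact_list q nu * q_fact_list q rho))"
proof -
  define g where "g a = q ^ (a choose 2) / q_fact q a" for a
  have g: "prod_list (map g nu) = q ^ n_stat (conj_partition nu) / q_fact_list q nu" for nu
    unfolding n_stat_conj_partition q_fact_list_def
    by (induction nu) (simp_all add: g_def power_add)
  have h: "gauss_binom (1 / q) (a + b) b = q_fact q (a + b) * (1 / q) ^ ((a + b) choose 2) * (g a * g b)" for a b
    using q by (simp add: gauss_binom_inverse g_def choose_2_add power_add power_one_over field_simps)
  have prod: "prod_list (map2 (\<lambda>a b. gauss_binom (1 / q) (a + b) b) al be) =
      q_fact_list q (map2 (+) al be) * (1 / q) ^ n_stat (conj_partition (map2 (+) al be)) *
       (prod_list (map g al) * prod_list (map g be))" if "length al = length be" for al be
    unfolding n_stat_conj_partition q_fact_list_def using that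
    by (induction al be rule: list_induct2) (simp_all add: h power_add mult_ac)
  have "coeff (prod_list (map (rogers_szego (1 / q)) lam)) b =
      (\<Sum>(al, be)\<in>weak_splits lam b. prod_list (map2 (\<lambda>a b. gauss_binom (1 / q) (a + b) b) al be))"
    by (rule coeff_prod_list_weak_splits) (simp add: gauss_binom_eq_0)
  also have "\<dots> = (\<Sum>(al, be)\<in>weak_splits lam b. q_fact_list q lam * (1 / q) ^ n_stat (conj_partition lam) *
       (prod_list (map g al) * prod_list (map g be)))"
  proof (intro sum.cong refl, clarify)
    fix al be assume "(al, be) \<in> weak_splits lam b"
    hence "length al = length be" "map2 (+) al be = lam" by (simp_all add: weak_splits_def)
    thus "prod_list (map2 (\<lambda>a b. gauss_binom (1 / q) (a + b) b) al be) =
       q_fact_list q lam * (1 / q) ^ n_stat (conj_partition lam) * (prod_list (map g al) * prod_list (map g be))"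
      using prod[of al be] by (simp only:)
  qed
  also have "\<dots> = q_fact_list q lam * (1 / q) ^ n_stat (conj_partition lam) *
      (\<Sum>nu\<in>partitions a. \<Sum>rho\<in>partitions b. prod_list (map g nu) * prod_list (map g rho) * hl_coeff lam nu rho 1)"
    using sum_hl_coeff[of g lam a b] lam
    by (simp add: g_def q_fact_def binomial_eq_0 case_prod_unfold flip: sum_distrib_left)
  also have "(\<Sum>nu\<in>partitions a. \<Sum>rho\<in>partitions b. prod_list (map g nu) * prod_list (map g rho) * hl_coeff lam nu rho 1)
     = (\<Sum>nu\<in>partitions a. \<Sum>rho\<in>partitions b.
       q ^ (n_stat (conj_partition nu) + n_stat (conj_partition rho)) * hl_coeff lam nu rho 1
         / (q_fact_list q nu * q_fact_list q rho))"
    by (intro sum.cong refl) (simp add: g power_add)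
  finally show ?thesis .
qed

theorem theorem2p5:
  fixes n k :: nat and lam :: "nat list" and q :: real
  assumes "q = real CARD('F::{field, finite})"
    and "lam \<in> partitions n"
    and "2 * k \<le> n"
  shows "real (a_count TYPE('F) n k lam) =
           q powi (int (n * k) - int (k ^ 2) - int (n_stat (conj_partition lam)))
           * q_fact_list q lam * a_bar q n k lam"
proof -
  define p where "p = 1 / q"
  have q1: "1 < q" using CARD_field_gt_1[where 'a = 'F] by (simp add: assms(1))
  hence p: "0 < p" "p < 1" by (auto simp: p_def)
  have n: "n = sum_list lam" using assms(2) by (simp add: partitions_def)
  let ?X = "nil_cols lam :: (nat \<Rightarrow> 'F) list set"
  let ?d = "inv_coeff p (n - 2 * k)"
  let ?N = "n_stat (conj_partition lam)"
  let ?P = "prod_list (map (rogers_szego p) lam)"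
  define S where "S j = (\<Sum>nu\<in>partitions (n - k + j). \<Sum>rho\<in>partitions (k - j).
       q ^ (n_stat (conj_partition nu) + n_stat (conj_partition rho)) * hl_coeff lam nu rho 1
         / (q_fact_list q nu * q_fact_list q rho))" for j
  \<comment> \<open>The functional of \<open>inv_coeff_rogers_szego\<close> is applied to both sides
    of \<open>sum_nil_cols\<close>; on the matrix side it discards every rank other than k.\<close>
  have "(\<Sum>j\<le>k. ?d j * coeff ?P (k - j)) = (\<Sum>j\<le>k. \<Sum>xs\<in>?X. p ^ (col_rank xs * (n - col_rank xs)) *
      (?d j * coeff (monom 1 (col_rank xs) * rogers_szego p (n - 2 * col_rank xs)) (k - j)))"
    using sum_nil_cols[where 'a = 'F, of lam]
    by (simp add: p_def assms(1) n coeff_sum sum_distrib_left mult_ac flip: sum_nil_cols[where 'a = 'F, of lam])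
  also have "\<dots> = (\<Sum>xs\<in>?X. p ^ (col_rank xs * (n - col_rank xs)) *
      (\<Sum>j\<le>k. ?d j * coeff (monom 1 (col_rank xs) * rogers_szego p (n - 2 * col_rank xs)) (k - j)))"
    by (subst sum.swap) (simp add: sum_distrib_left)
  also have "\<dots> = (\<Sum>xs\<in>?X. p ^ (col_rank xs * (n - col_rank xs)) * (if col_rank xs = k then 1 else 0))"
  proof (intro sum.cong refl arg_cong2[of _ _ _ _ "(*)"])
    fix xs assume "xs \<in> ?X"
    hence "2 * col_rank xs \<le> n" using nil_cols_rank n by blast
    thus "(\<Sum>j\<le>k. ?d j * coeff (monom 1 (col_rank xs) * rogers_szego p (n - 2 * col_rank xs)) (k - j))
        = (if col_rank xs = k then 1 else 0)"
      by (rule inv_coeff_rogers_szego[OF p assms(3)])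
  qed
  also have "\<dots> = (\<Sum>xs\<in>{xs \<in> ?X. col_rank xs = k}. p ^ (k * (n - k)))"
    by (rule sum.mono_neutral_cong_right) (auto simp: finite_nil_cols)
  also have "\<dots> = real (a_count TYPE('F) n k lam) * p ^ (k * (n - k))"
    by (simp add: a_count_eq_card_nil_cols[OF n])
  finally have "real (a_count TYPE('F) n k lam) = q ^ (k * (n - k)) * (\<Sum>j\<le>k. ?d j * coeff ?P (k - j))"
    using q1 by (simp add: p_def power_one_over)
  also have "(\<Sum>j\<le>k. ?d j * coeff ?P (k - j)) = (\<Sum>j\<le>k. ?d j * (q_fact_list q lam * p ^ ?N * S j))"
  proof (intro sum.cong refl arg_cong2[of _ _ _ _ "(*)"])
    fix j assume "j \<in> {..k}"
    hence "n = (n - k + j) + (k - j)" using assms(3) by simp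
    hence "lam \<in> partitions ((n - k + j) + (k - j))" using assms(2) by simp
    thus "coeff ?P (k - j) = q_fact_list q lam * p ^ ?N * S j"
      unfolding p_def S_def by (rule coeff_prod_rogers_szego[OF q1])
  qed
  also have "\<dots> = p ^ ?N * q_fact_list q lam * (\<Sum>j\<le>k. ?d j * S j)"
    by (simp add: sum_distrib_left mult_ac)
  also have "(\<Sum>j\<le>k. ?d j * S j) = a_bar q n k lam"
    unfolding a_bar_def p_def inv_coeff_inverse[OF q1] S_def ..
  also have "q ^ (k * (n - k)) * (p ^ ?N * q_fact_list q lam * a_bar q n k lam) =
     q powi (int (n * k) - int (k ^ 2) - int ?N) * q_fact_list q lam * a_bar q n k lam"
  proof -
    have "q powi (int a - int b) = q ^ a * p ^ b" for a b
      using q1 by (simp add: power_int_diff_of_nat p_def)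
    moreover have "int (n * k) - int (k ^ 2) = int (k * (n - k))"
      using assms(3) by (simp add: of_nat_diff algebra_simps power2_eq_square)
    ultimately have "q powi (int (n * k) - int (k ^ 2) - int ?N) = q ^ (k * (n - k)) * p ^ ?N"
      by (simp only:)
    thus ?thesis by simp
  qed
  finally show ?thesis .
qed

end
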